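(* Let $n\ge 1$. The functional $P_{\mathcal A}(\phi)=\int_{\mathbb R^n}e^{-\phi(x)}dx\int_{\mathbb R^n}e^{-\mathcal A\phi(x)}dx$ achieves a maximum and a minimum on the set of even functions in $\mathrm{Cvx}_0^+(\mathbb R^n)$. Moreover, $P_{\mathcal A}$ achieves a maximum and a minimum on the set of functions in $\mathrm{Cvx}_0^+(\mathbb R^n)$ whose centroid is $0$.
   Context: $\mathrm{Cvx}_0(\mathbb R^n)$ is the set of geometric convex functions, i.e. closed (lower semi-continuous) convex functions $\phi:\mathbb R^n\to[0,\infty]$ with $\phi(0)=0$. $\mathrm{Cvx}_0^+(\mathbb R^n)=\{\phi\in\mathrm{Cvx}_0(\mathbb R^n): 0<\int_{\mathbb R^n}e^{-\phi(x)}dx<\infty\}$ (with $e^{-\infty}=0$). The polarity transform $\mathcal A$ on $\mathrm{Cvx}_0(\mathbb R^n)$ is defined by $$\mathcal A\phi(y)=\begin{cases}\sup_{\{x\in\mathbb R^n:\phi(x)>0\}}\frac{\langle x,y\rangle-1}{\phi(x)} & \text{if } 0\ne y\in\{\phi^{-1}(0)\}^\circ,\\ 0&\text{if } y=0,\\ +\infty&\text{if } y\notin\{\phi^{-1}(0)\}^\circ,\end{cases}$$ where $S^\circ=\{y:\langle x,y\rangle\le 1\ \forall x\in S\}$ is the polar set and a quotient with denominator $+\infty$ is $0$. The centroid of $\phi$ is $c(\phi)=\frac{\int_{\mathbb R^n}xe^{-\phi(x)}dx}{\int_{\mathbb R^n}e^{-\phi(x)}dx}$. A function $\phi$ is even if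 $\phi(-x)=\phi(x)$ for all $x$. *)

theory Defs
  imports "HOL-Analysis.Analysis"
begin

text \<open>
  Functions with values in \<open>[0,\<infinity>]\<close> are modelled as \<open>ereal\<close>-valued functions with a sign
  condition, because the quotients in the polarity transform may be negative.
\<close>

definition lower_semicontinuous :: "('a::topological_space \<Rightarrow> ereal) \<Rightarrow> bool" where
  "lower_semicontinuous \<phi> \<longleftrightarrow> (\<forall>x. \<phi> x \<le> Liminf (at x) \<phi>)"

text \<open>
  Only meant for \<open>\<phi> \<ge> 0\<close>: then no \<open>\<infinity> - \<infinity>\<close> arises on the right-hand side, and since
  \<open>0 * \<infinity> = 0\<close> in \<open>ereal\<close> the endpoints \<open>t = 0\<close> and \<open>t = 1\<close> impose nothing.
\<close>
definition convex_ereal :: "('a::real_vector \<Rightarrow> ereal) \<Rightarrow> bool" where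
  "convex_ereal \<phi> \<longleftrightarrow>
     (\<forall>x y. \<forall>t\<in>{0..1}. \<phi> ((1 - t) *\<^sub>R x + t *\<^sub>R y) \<le> ereal (1 - t) * \<phi> x + ereal t * \<phi> y)"

definition Cvx0 :: "('a::euclidean_space \<Rightarrow> ereal) set" where
  "Cvx0 = {\<phi>. (\<forall>x. 0 \<le> \<phi> x) \<and> lower_semicontinuous \<phi> \<and> convex_ereal \<phi> \<and> \<phi> 0 = 0}"

definition exp_neg :: "ereal \<Rightarrow> real" where
  "exp_neg t = (if t = \<infinity> then 0 else exp (- real_of_ereal t))"

definition integral_exp_neg :: "('a::euclidean_space \<Rightarrow> ereal) \<Rightarrow> ennreal" where
  "integral_exp_neg \<phi> = (\<integral>\<^sup>+ x. ennreal (exp_neg (\<phi> x)) \<partial>lborel)"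

definition Cvx0_plus :: "('a::euclidean_space \<Rightarrow> ereal) set" where
  "Cvx0_plus = {\<phi> \<in> Cvx0. 0 < integral_exp_neg \<phi> \<and> integral_exp_neg \<phi> < \<infinity>}"

definition polar_set :: "'a::real_inner set \<Rightarrow> 'a set" where
  "polar_set S = {y. \<forall>x\<in>S. x \<bullet> y \<le> 1}"

text \<open>
  In \<open>ereal\<close> a real number divided by \<open>\<infinity>\<close> is \<open>0\<close>, as required. The supremum is taken in the
  extended reals; in its branch the index set is nonempty, since \<open>\<phi> = 0\<close> everywhere would force
  \<open>y = 0\<close>.
\<close>
definition polarity :: "('a::euclidean_space \<Rightarrow> ereal) \<Rightarrow> 'a \<Rightarrow> ereal" where
  "polarity \<phi> y =
     (if y = 0 then 0
      else if y \<in> polar_set (\<phi> -` {0}) then (SUP x\<in>{x. \<phi> x > 0}. ereal (x \<bullet> y - 1) / \<phi> x)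
      else \<infinity>)"

text \<open>
  Bochner integrals; for \<open>\<phi> \<in> Cvx0_plus\<close> both integrands are integrable, as \<open>exp (- \<phi>)\<close> is then
  log-concave with finite positive integral and hence decays exponentially.
\<close>
definition centroid :: "('a::euclidean_space \<Rightarrow> ereal) \<Rightarrow> 'a" where
  "centroid \<phi> = (\<integral>x. exp_neg (\<phi> x) *\<^sub>R x \<partial>lborel) /\<^sub>R (\<integral>x. exp_neg (\<phi> x) \<partial>lborel)"

definition even_fun :: "('a::euclidean_space \<Rightarrow> ereal) \<Rightarrow> bool" where
  "even_fun \<phi> \<longleftrightarrow> (\<forall>x. \<phi> (- x) = \<phi> x)"

definition P_A :: "('a::euclidean_space \<Rightarrow> ereal) \<Rightarrow> ennreal" where
  "P_A \<phi> = integral_exp_neg \<phi> * integral_exp_neg (polarity \<phi>)"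

text \<open>
  An attained extremum is required to be a real number: \<open>P_A\<close> is \<open>[0,\<infinity>]\<close>-valued, and
  the value \<open>\<infinity>\<close> does not count.
\<close>
definition achieves_max_on :: "('b \<Rightarrow> ennreal) \<Rightarrow> 'b set \<Rightarrow> bool" where
  "achieves_max_on F S \<longleftrightarrow> (\<exists>\<phi>\<^sub>0\<in>S. F \<phi>\<^sub>0 < \<infinity> \<and> (\<forall>\<phi>\<in>S. F \<phi> \<le> F \<phi>\<^sub>0))"

definition achieves_min_on :: "('b \<Rightarrow> ennreal) \<Rightarrow> 'b set \<Rightarrow> bool" where
  "achieves_min_on F S \<longleftrightarrow> (\<exists>\<phi>\<^sub>0\<in>S. F \<phi>\<^sub>0 < \<infinity> \<and> (\<forall>\<phi>\<in>S. F \<phi>\<^sub>0 \<le> F \<phi>))"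

end

theory Submission
  imports Defs
begin

text \<open>
  The proof is the direct method: up to a linear change of variables, the functions in question
  form a compact family on which \<open>P_A\<close> is continuous.

  Invariance. For an invertible matrix \<open>A\<close>, polarity turns \<open>\<phi> \<circ> A\<close> into \<open>\<A>\<phi> \<circ> A\<^sup>-\<^sup>T\<close>, so the two
  determinants cancel and \<open>P_A (\<phi> \<circ> A) = P_A \<phi>\<close> (\<open>P_A_matrix\<close>). Evenness and the condition that the
  centroid is \<open>0\<close> are preserved by \<open>A\<close> as well.

  Normal position. Let \<open>K = {\<phi> \<le> 1}\<close>. Among the matrices with columns in \<open>K\<close> take one whose
  determinant is at least half the supremum; by Cramer's rule all points of \<open>K\<close> have coordinates
  at most \<open>2\<close> in the basis of its columns (\<open>ex_normalising_matrix\<close>). In these coordinates convexity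
  gives a lower bound \<open>\<phi> x \<ge> a * norm x - 1\<close> with \<open>a\<close> depending only on the dimension. A
  matching upper bound \<open>\<phi> \<le> C\<close> on a fixed ball comes from the centroid: if \<open>\<phi>\<close> exceeded \<open>C\<close> very
  close to \<open>0\<close>, it would exceed \<open>C\<close> on almost a whole half-space through \<open>0\<close>, and the first moment
  in the normal direction could not vanish (\<open>uniform_upper_bound_of_centroid\<close>). An even function has centroid \<open>0\<close>, so the
  same position serves both classes. Functions with these two bounds are called pinched.

  Compactness. Every sequence of functions has a subsequence that epi-converges
  (\<open>epi_compactness\<close>), and epi-limits inherit convexity, lower semicontinuity, evenness and both
  bounds.

  Continuity. Along an epi-convergent sequence of pinched functions, \<open>\<phi>\<^sub>k\<close> is eventually bounded
  below by \<open>\<phi>\<close> at every point and bounded above by the values of \<open>\<phi>\<close> on a slightly dilated ray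
  point, and the polars \<open>\<A>\<phi>\<^sub>k\<close> satisfy the same two estimates with respect to \<open>\<A>\<phi>\<close>
  (\<open>epi_radial_upper\<close>, \<open>polarity_epi_lower\<close>, \<open>polarity_epi_upper\<close>). Since all these functions increase
  along rays, comparing the integral of \<open>exp (- \<psi>)\<close> with that of its dilates shows that dilating
  slightly changes almost nothing (\<open>radially_decreasing_AE_regular\<close>), so that \<open>exp (- \<phi>\<^sub>k)\<close> and
  \<open>exp (- \<A>\<phi>\<^sub>k)\<close> converge almost everywhere. Both families have a common integrable majorant: for
  \<open>\<phi>\<^sub>k\<close> from the lower bound, and for \<open>\<A>\<phi>\<^sub>k\<close> because the upper bound on a ball becomes linear growth
  under polarity. Dominated convergence yields the continuity of \<open>P_A\<close> and of the first moment.
\<close>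

section \<open>Geometric convex functions and their exponentials\<close>

lemma lower_semicontinuous_iff_open:
  "lower_semicontinuous \<phi> \<longleftrightarrow> (\<forall>c. open {x. c < \<phi> x})"
proof
  assume l: "lower_semicontinuous \<phi>"
  show "\<forall>c. open {x. c < \<phi> x}"
  proof
    fix c
    show "open {x. c < \<phi> x}"
    proof (subst open_subopen, clarify)
      fix x assume c: "c < \<phi> x"
      have "c < Liminf (at x) \<phi>"
        using l c less_le_trans unfolding lower_semicontinuous_def by blast
      then have "eventually (\<lambda>y. c < \<phi> y) (at x)"
        by (rule less_LiminfD)
      then obtain T where "open T" "x \<in> T" "\<forall>y\<in>T. y \<noteq> x \<longrightarrow> c < \<phi> y"
        unfolding eventually_at_topological by auto
      then show "\<exists>T. open T \<and> x \<in> T \<and> T \<subseteq> {x. c < \<phi> x}"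
        using c by (intro exI[of _ T]) auto
    qed
  qed
next
  assume "\<forall>c. open {x. c < \<phi> x}"
  then show "lower_semicontinuous \<phi>"
    unfolding lower_semicontinuous_def le_Liminf_iff eventually_at_topological
    by (metis mem_Collect_eq)
qed

lemma lower_semicontinuous_iff_closed:
  "lower_semicontinuous \<phi> \<longleftrightarrow> (\<forall>c. closed {x. \<phi> x \<le> c})"
proof -
  have eq: "- {x. \<phi> x \<le> c} = {x. c < \<phi> x}" for c by auto
  show ?thesis unfolding lower_semicontinuous_iff_open closed_def eq ..
qed

lemma Cvx0_nonneg: "\<phi> \<in> Cvx0 \<Longrightarrow> 0 \<le> \<phi> x"
  and Cvx0_zero: "\<phi> \<in> Cvx0 \<Longrightarrow> \<phi> 0 = 0"
  and Cvx0_open: "\<phi> \<in> Cvx0 \<Longrightarrow> open {x. c < \<phi> x}"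
  and Cvx0_closed: "\<phi> \<in> Cvx0 \<Longrightarrow> closed {x. \<phi> x \<le> c}"
  unfolding Cvx0_def
  using lower_semicontinuous_iff_open lower_semicontinuous_iff_closed by auto

lemma Cvx0_convexD:
  assumes "\<phi> \<in> Cvx0" "0 \<le> t" "t \<le> 1"
  shows "\<phi> ((1 - t) *\<^sub>R x + t *\<^sub>R y) \<le> ereal (1 - t) * \<phi> x + ereal t * \<phi> y"
  using assms unfolding Cvx0_def convex_ereal_def by auto

lemma Cvx0_convex_le:
  assumes "\<phi> \<in> Cvx0" "0 \<le> t" "t \<le> 1" "\<phi> x \<le> ereal p" "\<phi> y \<le> ereal q"
  shows "\<phi> ((1 - t) *\<^sub>R x + t *\<^sub>R y) \<le> ereal ((1 - t) * p + t * q)"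
proof -
  have "ereal (1 - t) * \<phi> x + ereal t * \<phi> y \<le> ereal (1 - t) * ereal p + ereal t * ereal q"
    using assms by (intro add_mono ereal_mult_left_mono) auto
  then show ?thesis
    using Cvx0_convexD[OF assms(1-3), of x y] by (auto intro: order_trans)
qed

lemma Cvx0_scale_le:
  assumes "\<phi> \<in> Cvx0" "0 \<le> t" "t \<le> 1" "\<phi> x \<le> ereal p"
  shows "\<phi> (t *\<^sub>R x) \<le> ereal (t * p)"
  using Cvx0_convex_le[OF assms(1-3), of 0 0 x p] assms by (simp add: Cvx0_zero)

lemma Cvx0_radial_mono:
  assumes "\<phi> \<in> Cvx0" "1 \<le> s"
  shows "\<phi> x \<le> \<phi> (s *\<^sub>R x)"
proof (cases "\<phi> (s *\<^sub>R x)")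
  case (real p)
  have "\<phi> ((1 / s) *\<^sub>R (s *\<^sub>R x)) \<le> ereal (1 / s * p)"
    using assms real by (intro Cvx0_scale_le) auto
  moreover have "0 \<le> p" using Cvx0_nonneg[OF assms(1), of "s *\<^sub>R x"] real by simp
  then have "1 / s * p \<le> p" using assms mult_left_mono[of 1 s p] by (simp add: field_simps)
  moreover have "(1 / s) *\<^sub>R (s *\<^sub>R x) = x" using assms by simp
  ultimately show ?thesis using real by (auto intro: order_trans)
next
  case MInf then show ?thesis using Cvx0_nonneg[OF assms(1), of "s *\<^sub>R x"] by simp
qed simp

lemma convex_Cvx0_sublevel:
  assumes "\<phi> \<in> Cvx0"
  shows "convex {x. \<phi> x \<le> ereal c}"
  unfolding convex_alt
proof clarify
  fix x y t assume *: "\<phi> x \<le> ereal c" "\<phi> y \<le> ereal c" "0 \<le> t" "t \<le> (1::real)"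
  have "(1 - t) * c + t * c = c" by (simp add: algebra_simps)
  then show "\<phi> ((1 - t) *\<^sub>R x + t *\<^sub>R y) \<le> ereal c"
    using Cvx0_convex_le[OF assms *(3,4,1,2)] by simp
qed

lemma lsc_borel_measurable:
  fixes \<phi> :: "'a::euclidean_space \<Rightarrow> ereal"
  assumes "\<And>c. closed {x. \<phi> x \<le> c}"
  shows "\<phi> \<in> borel_measurable borel"
  unfolding borel_measurable_iff_Iic_ereal
proof
  fix a
  have "\<phi> -` {..a} \<inter> space borel = {x. \<phi> x \<le> a}" by auto
  then show "\<phi> -` {..a} \<inter> space borel \<in> sets borel" using assms[of a] by auto
qed

lemma Cvx0_measurable: "\<phi> \<in> Cvx0 \<Longrightarrow> \<phi> \<in> borel_measurable borel"
  by (intro lsc_borel_measurable Cvx0_closed)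

lemma exp_neg_measurable [measurable]: "exp_neg \<in> borel_measurable borel"
  unfolding exp_neg_def by measurable

lemma exp_neg_measurable_comp:
  "\<phi> \<in> borel_measurable borel \<Longrightarrow> (\<lambda>x. exp_neg (\<phi> x)) \<in> borel_measurable borel"
  by measurable

lemma exp_neg_ereal [simp]: "exp_neg (ereal x) = exp (- x)"
  and exp_neg_PInf [simp]: "exp_neg \<infinity> = 0"
  and exp_neg_nonneg [simp]: "0 \<le> exp_neg t"
  by (auto simp: exp_neg_def)

lemma exp_neg_antimono: "0 \<le> s \<Longrightarrow> s \<le> t \<Longrightarrow> exp_neg t \<le> exp_neg s"
  by (cases s; cases t) auto

lemma exp_neg_strict_antimono: "0 \<le> s \<Longrightarrow> s < t \<Longrightarrow> exp_neg t < exp_neg s"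
  by (cases s; cases t) auto

text \<open>
  Sequences of finite values tending to \<open>\<infinity>\<close> are included; this is where continuity of
  \<open>exp_neg\<close> is more than continuity of \<open>exp\<close>.
\<close>
lemma tendsto_exp_neg:
  assumes lim: "(g \<longlongrightarrow> l) F" and l: "0 \<le> l" and nonneg: "\<And>k. 0 \<le> g k"
  shows "((\<lambda>k. exp_neg (g k)) \<longlongrightarrow> exp_neg l) F"
proof (cases l)
  case (real x)
  have "((\<lambda>k. real_of_ereal (g k)) \<longlongrightarrow> x) F"
    by (rule lim_real_of_ereal[OF lim[unfolded real]])
  then have "((\<lambda>k. exp (- real_of_ereal (g k))) \<longlongrightarrow> exp (- x)) F"
    by (intro tendsto_exp tendsto_minus)
  moreover have "eventually (\<lambda>k. g k < \<infinity>) F"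
    using order_tendstoD(2)[OF lim, of \<infinity>] real by simp
  then have "eventually (\<lambda>k. exp (- real_of_ereal (g k)) = exp_neg (g k)) F"
    by eventually_elim (auto simp: exp_neg_def)
  ultimately show ?thesis unfolding real exp_neg_ereal by (rule Lim_transform_eventually)
next
  case PInf
  show ?thesis unfolding PInf exp_neg_PInf
  proof (rule tendstoI)
    fix e :: real assume e: "0 < e"
    have "eventually (\<lambda>k. ereal (- ln e) < g k) F"
      using lim PInf by (intro order_tendstoD) auto
    then show "eventually (\<lambda>k. dist (exp_neg (g k)) 0 < e) F"
    proof eventually_elim
      case (elim k)
      show ?case
      proof (cases "g k")
        case (real p)
        then have "exp (- p) < exp (ln e)" using elim by (subst exp_less_cancel_iff) auto
        then show ?thesis using real e by simp
      qed (use e nonneg[of k] in auto)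
    qed
  qed
qed (use l in auto)

section \<open>The polarity transform\<close>

text \<open>
  Multiplying the quotient out removes the case distinction: the three branches of the definition
  become a single family of affine conditions on \<open>(c, y)\<close>. A point with \<open>\<phi> x = 0\<close> imposes exactly
  the polar set condition, and a point with \<open>\<phi> x = \<infinity>\<close> imposes nothing as \<open>c \<ge> 0\<close>. All further
  properties of the transform are read off from this description.
\<close>
lemma polarity_le_iff:
  assumes \<phi>: "\<phi> \<in> Cvx0" and c: "0 \<le> c"
  shows "polarity \<phi> y \<le> ereal c \<longleftrightarrow> (\<forall>x p. \<phi> x = ereal p \<longrightarrow> x \<bullet> y \<le> 1 + c * p)"
proof (cases "y = 0")
  case True
  have "0 \<le> p" if "\<phi> x = ereal p" for x p using Cvx0_nonneg[OF \<phi>, of x] that by simp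
  then show ?thesis using c True by (auto simp: polarity_def)
next
  case y: False
  show ?thesis
  proof (cases "y \<in> polar_set (\<phi> -` {0})")
    case False
    then obtain x where "\<phi> x = 0" "\<not> x \<bullet> y \<le> 1" by (auto simp: polar_set_def)
    then show ?thesis using False y by (auto simp: polarity_def zero_ereal_def intro!: exI[of _ x])
  next
    case True
    have "polarity \<phi> y \<le> ereal c \<longleftrightarrow> (\<forall>x. 0 < \<phi> x \<longrightarrow> ereal (x \<bullet> y - 1) / \<phi> x \<le> ereal c)"
      using True y by (auto simp: polarity_def SUP_le_iff)
    also have "\<dots> \<longleftrightarrow> (\<forall>x p. \<phi> x = ereal p \<longrightarrow> x \<bullet> y \<le> 1 + c * p)"
    proof (intro iff_allI)
      fix x
      show "(0 < \<phi> x \<longrightarrow> ereal (x \<bullet> y - 1) / \<phi> x \<le> ereal c) \<longleftrightarrow>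
            (\<forall>p. \<phi> x = ereal p \<longrightarrow> x \<bullet> y \<le> 1 + c * p)"
      proof (cases "\<phi> x")
        case (real p)
        show ?thesis
        proof (cases "p = 0")
          case True
          then show ?thesis using real \<open>y \<in> polar_set _\<close> by (auto simp: polar_set_def zero_ereal_def)
        next
          case False
          then have "0 < p" using Cvx0_nonneg[OF \<phi>, of x] real by auto
          then show ?thesis using real by (auto simp: field_simps)
        qed
      qed (use c Cvx0_nonneg[OF \<phi>, of x] in auto)
    qed
    finally show ?thesis .
  qed
qed

text \<open>
  The supremum could only be negative if it missed points with \<open>x \<bullet> y \<ge> 1\<close>. The point of the ray
  through \<open>y\<close> with \<open>x \<bullet> y = 2\<close> is such a point, and \<open>\<phi> x > 0\<close> there because \<open>y\<close> is in the polar set.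
\<close>
lemma polarity_nonneg:
  assumes \<phi>: "\<phi> \<in> Cvx0"
  shows "0 \<le> polarity \<phi> y"
proof (cases "y = 0 \<or> y \<notin> polar_set (\<phi> -` {0})")
  case True
  then show ?thesis by (auto simp: polarity_def)
next
  case False
  define x where "x = (2 / (y \<bullet> y)) *\<^sub>R y"
  have xy: "x \<bullet> y = 2" using False by (simp add: x_def)
  then have "\<phi> x \<noteq> 0" using False by (force simp: polar_set_def)
  then have pos: "0 < \<phi> x" using Cvx0_nonneg[OF \<phi>, of x] by simp
  have "0 \<le> ereal (x \<bullet> y - 1) / \<phi> x" using pos xy by (cases "\<phi> x") auto
  also have "\<dots> \<le> polarity \<phi> y" using False pos by (auto simp: polarity_def intro!: SUP_upper)
  finally show ?thesis .
qed

lemma less_polarityD: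
  assumes "\<phi> \<in> Cvx0" "0 \<le> c" "ereal c < polarity \<phi> y"
  obtains x p where "\<phi> x = ereal p" "1 + c * p < x \<bullet> y"
  using assms polarity_le_iff[OF assms(1,2), of y] by (metis not_le)

lemma less_polarityI:
  assumes "\<phi> \<in> Cvx0" "0 \<le> c" "\<phi> x \<le> ereal p" "1 + c * p < x \<bullet> y"
  shows "ereal c < polarity \<phi> y"
proof -
  obtain q where q: "\<phi> x = ereal q" "q \<le> p"
    using assms Cvx0_nonneg[OF assms(1), of x] by (cases "\<phi> x") auto
  then have "1 + c * q < x \<bullet> y" using assms mult_left_mono[of q p c] by linarith
  then show ?thesis using q polarity_le_iff[OF assms(1,2), of y] by (metis not_le)
qed

text \<open>
  Sublevel sets at real heights determine a function with values in \<open>[0,\<infinity>]\<close>; in this form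
  \<open>polarity_le_iff\<close> proves identities between polars.
\<close>
lemma nonneg_ereal_eqI:
  fixes a b :: ereal
  assumes "0 \<le> a" "0 \<le> b" "\<And>c. 0 \<le> c \<Longrightarrow> a \<le> ereal c \<longleftrightarrow> b \<le> ereal c"
  shows "a = b"
proof (cases a; cases b)
  fix p q assume "a = ereal p" "b = ereal q"
  then show ?thesis using assms(1,2) assms(3)[of p] assms(3)[of q] by (auto simp: zero_ereal_def)
next
  fix p assume "a = ereal p" "b = \<infinity>"
  then show ?thesis using assms assms(3)[of p] by auto
next
  fix p assume "b = ereal p" "a = \<infinity>"
  then show ?thesis using assms assms(3)[of p] by auto
qed (use assms in auto)

lemma closed_polarity_sublevel:
  assumes \<phi>: "\<phi> \<in> Cvx0"
  shows "closed {y. polarity \<phi> y \<le> c}"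
proof (cases c)
  case (real r)
  show ?thesis
  proof (cases "0 \<le> r")
    case True
    have "{y. polarity \<phi> y \<le> c} = (\<Inter>x\<in>{x. \<phi> x < \<infinity>}. {y. x \<bullet> y \<le> 1 + r * real_of_ereal (\<phi> x)})"
    proof -
      have "(\<forall>p. \<phi> x = ereal p \<longrightarrow> x \<bullet> y \<le> 1 + r * p) \<longleftrightarrow> 
        (\<phi> x < \<infinity> \<longrightarrow> x \<bullet> y \<le> 1 + r * real_of_ereal (\<phi> x))" for x y
        using Cvx0_nonneg[OF \<phi>, of x] by (cases "\<phi> x") auto
      then show ?thesis unfolding real polarity_le_iff[OF \<phi> True] by auto
    qed
    also have "closed \<dots>" by (intro closed_INT ballI closed_halfspace_le)
    finally show ?thesis .
  next
    case False
    then have "{y. polarity \<phi> y \<le> c} = {}" 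
      using order_trans[OF polarity_nonneg[OF \<phi>], of _ c] real by auto
    then show ?thesis by simp
  qed
next
  case MInf
  then have "{y. polarity \<phi> y \<le> c} = {}" using polarity_nonneg[OF \<phi>] by auto
  then show ?thesis by simp
qed auto

lemma polarity_measurable: "\<phi> \<in> Cvx0 \<Longrightarrow> polarity \<phi> \<in> borel_measurable borel"
  by (intro lsc_borel_measurable closed_polarity_sublevel)

lemma polarity_radial_mono:
  assumes \<phi>: "\<phi> \<in> Cvx0" and s: "1 \<le> s"
  shows "polarity \<phi> y \<le> polarity \<phi> (s *\<^sub>R y)"
proof (cases "polarity \<phi> (s *\<^sub>R y)")
  case (real c)
  then have c: "0 \<le> c" using polarity_nonneg[OF \<phi>, of "s *\<^sub>R y"] by simp
  have "x \<bullet> y \<le> 1 + c * p" if x: "\<phi> x = ereal p" for x p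
  proof (cases "x \<bullet> y \<le> 0")
    case True
    have "0 \<le> p" using x Cvx0_nonneg[OF \<phi>, of x] by simp
    then have "0 \<le> c * p" using c by simp
    then show ?thesis using True by linarith
  next
    case False
    then have "x \<bullet> y \<le> s * (x \<bullet> y)" using s by simp
    also have "\<dots> \<le> 1 + c * p" using real polarity_le_iff[OF \<phi> c, of "s *\<^sub>R y"] x by auto
    finally show ?thesis .
  qed
  then show ?thesis using real polarity_le_iff[OF \<phi> c, of y] by auto
qed (use polarity_nonneg[OF \<phi>, of "s *\<^sub>R y"] in auto)

text \<open>
  Test the supremum with the point \<open>x\<close> of norm \<open>r / 2\<close> in the direction of \<open>y\<close>, where
  \<open>\<phi> x \<le> C\<close>.
\<close>
lemma polarity_linear_growth:
  assumes \<phi>: "\<phi> \<in> Cvx0" and rC: "0 < r" "0 < C" and bd: "\<And>x. norm x < r \<Longrightarrow> \<phi> x \<le> ereal C"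
  shows "ereal (r / (2 * C) * norm y - 1 / C) \<le> polarity \<phi> y"
proof (cases "polarity \<phi> y")
  case (real c)
  then have c: "0 \<le> c" using polarity_nonneg[OF \<phi>, of y] by simp
  show ?thesis
  proof (cases "y = 0")
    case True then show ?thesis using real c rC by (simp add: order_trans[of _ 0])
  next
    case False
    define x where "x = (r / 2 / norm y) *\<^sub>R y"
    have "norm x < r" using False rC by (simp add: x_def)
    then have "\<phi> x \<le> ereal C" by (rule bd)
    then have "\<not> 1 + c * C < x \<bullet> y" using less_polarityI[OF \<phi> c] real by fastforce
    moreover have "x \<bullet> y = r / 2 * norm y"
      using False by (simp add: x_def dot_square_norm power2_eq_square)
    ultimately show ?thesis using real rC by (simp add: field_simps)
  qed
qed (use polarity_nonneg[OF \<phi>, of y] in auto)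

section \<open>Epi-convergence\<close>

text \<open>
  Epi-convergence (De Giorgi's \<open>\<Gamma>\<close>-convergence) in its neighbourhood form: the first half is the
  lower bound along arbitrary sequences \<open>x\<^sub>k \<longrightarrow> x\<close>, the second half says that recovery sequences exist.
\<close>
definition epi_converges :: "(nat \<Rightarrow> 'a::topological_space \<Rightarrow> ereal) \<Rightarrow> ('a \<Rightarrow> ereal) \<Rightarrow> bool" where
  "epi_converges \<phi>s \<phi> \<longleftrightarrow>
     (\<forall>x c. c < \<phi> x \<longrightarrow> (\<exists>U. open U \<and> x \<in> U \<and> (\<forall>\<^sub>F k in sequentially. \<forall>z\<in>U. c < \<phi>s k z))) \<and>
     (\<forall>x c U. \<phi> x < c \<longrightarrow> open U \<longrightarrow> x \<in> U \<longrightarrow> (\<forall>\<^sub>F k in sequentially. \<exists>z\<in>U. \<phi>s k z < c))"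

lemma epi_lower:
  assumes "epi_converges \<phi>s \<phi>" "c < \<phi> x"
  obtains U where "open U" "x \<in> U" "\<forall>\<^sub>F k in sequentially. \<forall>z\<in>U. c < \<phi>s k z"
  using assms unfolding epi_converges_def by blast

lemma epi_upper:
  assumes "epi_converges \<phi>s \<phi>" "\<phi> x < c" "open U" "x \<in> U"
  shows "\<forall>\<^sub>F k in sequentially. \<exists>z\<in>U. \<phi>s k z < c"
  using assms unfolding epi_converges_def by blast

lemma epi_lower_pointwise:
  assumes "epi_converges \<phi>s \<phi>" "c < \<phi> x"
  shows "\<forall>\<^sub>F k in sequentially. c < \<phi>s k x"
proof -
  obtain U where "x \<in> U" "\<forall>\<^sub>F k in sequentially. \<forall>z\<in>U. c < \<phi>s k z"
    using epi_lower[OF assms] by blast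
  then show ?thesis by (auto elim: eventually_mono)
qed

lemma epi_eventually_lower_imp:
  assumes epi: "epi_converges \<phi>s \<phi>" and U: "open U" "x \<in> U"
    and ev: "\<forall>\<^sub>F k in sequentially. \<forall>z\<in>U. c \<le> \<phi>s k z"
  shows "c \<le> \<phi> x"
proof (rule ccontr)
  assume "\<not> c \<le> \<phi> x"
  then have "\<forall>\<^sub>F k in sequentially. \<exists>z\<in>U. \<phi>s k z < c"
    using epi_upper[OF epi _ U] by simp
  with ev have "\<forall>\<^sub>F k in sequentially. False" by eventually_elim force
  then show False by simp
qed

lemma epi_upper_bound:
  assumes epi: "epi_converges \<phi>s \<phi>" and ev: "\<And>k. \<phi>s k x \<le> c"
  shows "\<phi> x \<le> c"
proof (rule ccontr)
  assume "\<not> \<phi> x \<le> c"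
  then have "\<forall>\<^sub>F k in sequentially. c < \<phi>s k x"
    using epi_lower_pointwise[OF epi] by simp
  then have "\<forall>\<^sub>F k in sequentially. False" by eventually_elim (use ev not_le in blast)
  then show False by simp
qed

lemma epi_limit_lsc:
  assumes epi: "epi_converges \<phi>s \<phi>"
  shows "lower_semicontinuous \<phi>"
  unfolding lower_semicontinuous_iff_open
proof
  fix c
  show "open {x. c < \<phi> x}"
  proof (subst open_subopen, clarify)
    fix x assume "c < \<phi> x"
    then obtain d where d: "c < d" "d < \<phi> x" using dense by blast
    obtain U where U: "open U" "x \<in> U" "\<forall>\<^sub>F k in sequentially. \<forall>z\<in>U. d < \<phi>s k z"
      using epi_lower[OF epi d(2)] by blast
    have "\<forall>\<^sub>F k in sequentially. \<forall>z\<in>U. d \<le> \<phi>s k z"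
      using U(3) by eventually_elim (auto intro: less_imp_le)
    then have "d \<le> \<phi> y" if "y \<in> U" for y
      by (rule epi_eventually_lower_imp[OF epi U(1) that])
    then show "\<exists>T. open T \<and> x \<in> T \<and> T \<subseteq> {x. c < \<phi> x}"
      using U d by (intro exI[of _ U]) (auto intro: less_le_trans)
  qed
qed

lemma seq_compact_UNIV_ereal: "seq_compact (UNIV :: ereal set)"
  unfolding seq_compact_def using compact_complete_linorder by blast

text \<open>
  Tychonoff's theorem replaces a diagonal argument.
\<close>
lemma compact_sequence_space_ereal: "compact (UNIV :: (nat \<Rightarrow> ereal) set)"
proof -
  have "compact (UNIV :: ereal set)"
    using seq_compact_UNIV_ereal seq_compact_eq_compact by blast
  then have "compact_space (product_topology (\<lambda>_::nat. euclidean :: ereal topology) UNIV)"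
    by (subst compact_space_product_topology) (simp add: compact_space_def)
  then show ?thesis
    by (simp add: euclidean_product_topology compact_space_def)
qed

lemma ereal_sequences_common_subsequence:
  fixes m :: "nat \<Rightarrow> nat \<Rightarrow> ereal"
  obtains r l where "strict_mono r" "\<And>i. (\<lambda>k. m (r k) i) \<longlonglongrightarrow> l i"
proof -
  have "seq_compact (UNIV :: (nat \<Rightarrow> ereal) set)"
    using compact_sequence_space_ereal seq_compact_eq_compact by blast
  then obtain l r where r: "strict_mono r" "(m \<circ> r) \<longlonglongrightarrow> l"
    unfolding seq_compact_def by (metis UNIV_I)
  have "(\<lambda>k. m (r k) i) \<longlonglongrightarrow> l i" for i
  proof -
    have "continuous_on UNIV (\<lambda>f::nat \<Rightarrow> ereal. f i)" by (rule continuous_on_product_coordinates)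
    from continuous_on_tendsto_compose[OF this r(2)] show ?thesis by (simp add: o_def)
  qed
  with r(1) show thesis by (rule that)
qed

text \<open>
  Only the infima over the members of a countable basis matter. After passing to a subsequence all of
  them converge, say to \<open>m i\<close> on \<open>B i\<close>, and the supremum of \<open>m i\<close> over the basic neighbourhoods of a
  point is the value of the limit there.
\<close>
lemma epi_compactness:
  fixes \<phi>s :: "nat \<Rightarrow> 'a::second_countable_topology \<Rightarrow> ereal"
  obtains r \<phi> where "strict_mono r" "epi_converges (\<lambda>k. \<phi>s (r k)) \<phi>"
proof -
  obtain \<B> :: "'a set set" where \<B>: "countable \<B>" "topological_basis \<B>"
    using ex_countable_basis by blast
  define B where "B = from_nat_into \<B>"
  have "\<B> \<noteq> {}" using \<B>(2) topological_basisE[OF \<B>(2) open_UNIV] by blast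
  then have B: "B i \<in> \<B>" "\<exists>j. U = B j" if "U \<in> \<B>" for i U
    unfolding B_def using from_nat_into \<B>(1) from_nat_into_surj[OF \<B>(1) that] by metis+
  have openB: "open (B i)" for i
    using \<B>(2) \<open>\<B> \<noteq> {}\<close> B(1) topological_basis_open by (metis ex_in_conv)
  obtain r m where r: "strict_mono r"
    and m: "\<And>i. (\<lambda>k. INF z\<in>B i. \<phi>s (r k) z) \<longlonglongrightarrow> m i"
    using ereal_sequences_common_subsequence[of "\<lambda>k i. INF z\<in>B i. \<phi>s k z"] by blast
  define \<phi> where "\<phi> x = (SUP i\<in>{i. x \<in> B i}. m i)" for x
  have "epi_converges (\<lambda>k. \<phi>s (r k)) \<phi>"
    unfolding epi_converges_def
  proof (intro conjI allI impI)
    fix x c assume "c < \<phi> x"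
    then obtain i where i: "x \<in> B i" "c < m i" unfolding \<phi>_def less_SUP_iff by auto
    have "\<forall>\<^sub>F k in sequentially. c < (INF z\<in>B i. \<phi>s (r k) z)"
      using m i(2) by (rule order_tendstoD)
    then have "\<forall>\<^sub>F k in sequentially. \<forall>z\<in>B i. c < \<phi>s (r k) z"
      by eventually_elim (auto dest: less_INF_D)
    then show "\<exists>U. open U \<and> x \<in> U \<and> (\<forall>\<^sub>F k in sequentially. \<forall>z\<in>U. c < \<phi>s (r k) z)"
      using openB i by blast
  next
    fix x c U assume c: "\<phi> x < c" and U: "open U" "x \<in> U"
    obtain V where "V \<in> \<B>" "x \<in> V" "V \<subseteq> U" using topological_basisE[OF \<B>(2) U] by blast
    with B(2) obtain i where i: "x \<in> B i" "B i \<subseteq> U" by metis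
    have "m i \<le> \<phi> x" unfolding \<phi>_def using i by (intro SUP_upper) simp
    then have "\<forall>\<^sub>F k in sequentially. (INF z\<in>B i. \<phi>s (r k) z) < c"
      using order_tendstoD(2)[OF m] c by (auto intro: le_less_trans)
    then show "\<forall>\<^sub>F k in sequentially. \<exists>z\<in>U. \<phi>s (r k) z < c"
      by eventually_elim (use i(2) in \<open>auto simp: INF_less_iff\<close>)
  qed
  with r show thesis by (rule that)
qed

text \<open>
  If convexity failed at \<open>z = (1 - t) x + t y\<close> by a margin, take points \<open>u\<close>, \<open>v\<close> near \<open>x\<close>, \<open>y\<close> where
  \<open>\<phi>\<^sub>k\<close> is not much larger than \<open>\<phi> x\<close>, \<open>\<phi> y\<close>; then \<open>(1 - t) u + t v\<close> is close to \<open>z\<close>, and the lower bound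
  near \<open>z\<close> contradicts convexity of \<open>\<phi>\<^sub>k\<close>.
\<close>
lemma epi_limit_convex:
  fixes \<phi>s :: "nat \<Rightarrow> 'a::real_normed_vector \<Rightarrow> ereal"
  assumes epi: "epi_converges \<phi>s \<phi>" and conv: "\<And>k. convex_ereal (\<phi>s k)"
    and nonneg: "\<And>x. 0 \<le> \<phi> x"
  shows "convex_ereal \<phi>"
  unfolding convex_ereal_def
proof (intro allI ballI)
  fix x y and t :: real assume "t \<in> {0..1}"
  then consider "t = 0" | "t = 1" | "0 < t" "t < 1" by fastforce
  then show "\<phi> ((1 - t) *\<^sub>R x + t *\<^sub>R y) \<le> ereal (1 - t) * \<phi> x + ereal t * \<phi> y"
  proof cases
    case 3
    show ?thesis
    proof (cases "\<phi> x = \<infinity> \<or> \<phi> y = \<infinity>")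
      case True
      then show ?thesis using 3 nonneg[of x] nonneg[of y] by (cases "\<phi> x"; cases "\<phi> y") auto
    next
      case False
      then obtain p q where pq: "\<phi> x = ereal p" "\<phi> y = ereal q"
        using nonneg[of x] nonneg[of y] by (cases "\<phi> x"; cases "\<phi> y") auto
      let ?z = "(1 - t) *\<^sub>R x + t *\<^sub>R y"
      have "\<phi> ?z \<le> ereal ((1 - t) * p + t * q) + ereal e" if e: "0 < e" for e
      proof (rule ccontr)
        assume "\<not> \<phi> ?z \<le> ereal ((1 - t) * p + t * q) + ereal e"
        then have "ereal ((1 - t) * p + t * q + e) < \<phi> ?z" by simp
        from epi_lower[OF epi this] obtain U where U: "open U" "?z \<in> U"
          and ev: "\<forall>\<^sub>F k in sequentially. \<forall>z\<in>U. ereal ((1 - t) * p + t * q + e) < \<phi>s k z" by blast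
        obtain d where d: "0 < d" "ball ?z d \<subseteq> U" using U openE by blast
        have "\<forall>\<^sub>F k in sequentially. \<exists>u\<in>ball x d. \<phi>s k u < ereal (p + e)"
             "\<forall>\<^sub>F k in sequentially. \<exists>v\<in>ball y d. \<phi>s k v < ereal (q + e)"
          using pq e d by (simp_all add: epi_upper[OF epi, of x] epi_upper[OF epi, of y])
        with ev have "\<forall>\<^sub>F k in sequentially. False"
        proof eventually_elim
          case (elim k)
          then obtain u v where uv: "dist x u < d" "dist y v < d"
            "\<phi>s k u < ereal (p + e)" "\<phi>s k v < ereal (q + e)" by auto
          let ?w = "(1 - t) *\<^sub>R u + t *\<^sub>R v"
          have "dist ?z ?w = norm ((1 - t) *\<^sub>R (x - u) + t *\<^sub>R (y - v))"
            unfolding dist_norm by (simp add: algebra_simps)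
          also have "\<dots> \<le> (1 - t) * dist x u + t * dist y v"
            using 3 by (intro norm_triangle_le) (simp add: dist_norm)
          also have "\<dots> < (1 - t) * d + t * d"
            using 3 uv by (intro add_strict_mono mult_strict_left_mono) auto
          finally have "dist ?z ?w < d" by (simp add: algebra_simps)
          then have "?w \<in> U" using d by auto
          then have "ereal ((1 - t) * p + t * q + e) < \<phi>s k ?w" using elim by blast
          also have "\<dots> \<le> ereal (1 - t) * \<phi>s k u + ereal t * \<phi>s k v"
            using conv[of k] 3 unfolding convex_ereal_def by auto
          also have "\<dots> \<le> ereal (1 - t) * ereal (p + e) + ereal t * ereal (q + e)"
            using 3 uv by (intro add_mono ereal_mult_left_mono) auto
          finally show False by (simp add: algebra_simps)
        qed
        then show False by simp
      qed
      then have "\<phi> ?z \<le> ereal ((1 - t) * p + t * q)" by (rule ereal_le_epsilon2)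
      then show ?thesis unfolding pq by simp
    qed
  qed (auto simp flip: zero_ereal_def one_ereal_def)
qed

section \<open>Pinched functions\<close>

text \<open>
  Functions caught between a cone from below and a cylinder from above. These are the bounds that the
  normal position provides, and under which epi-convergence controls all integrals.
\<close>
definition pinched :: "real \<Rightarrow> real \<Rightarrow> real \<Rightarrow> real \<Rightarrow> ('a::euclidean_space \<Rightarrow> ereal) \<Rightarrow> bool" where
  "pinched a b r C \<phi> \<longleftrightarrow> \<phi> \<in> Cvx0 \<and> (\<forall>x. ereal (a * norm x - b) \<le> \<phi> x) \<and>
     (\<forall>x. norm x < r \<longrightarrow> \<phi> x \<le> ereal C)"

lemma pinched_epi_limit:
  assumes epi: "epi_converges \<phi>s \<phi>" and p: "\<And>k. pinched a b r C (\<phi>s k)"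
  shows "pinched a b r C \<phi>"
proof -
  have cvx: "\<phi>s k \<in> Cvx0" for k using p[of k] by (simp add: pinched_def)
  have nonneg: "0 \<le> \<phi> x" for x
    by (rule epi_eventually_lower_imp[OF epi open_UNIV]) (auto simp: Cvx0_nonneg[OF cvx])
  have "\<phi> 0 \<le> 0"
    by (rule epi_upper_bound[OF epi]) (simp add: Cvx0_zero[OF cvx])
  then have "\<phi> 0 = 0" using nonneg[of 0] by simp
  moreover have "convex_ereal \<phi>"
    using cvx by (intro epi_limit_convex[OF epi] nonneg) (simp add: Cvx0_def)
  ultimately have "\<phi> \<in> Cvx0" using nonneg epi_limit_lsc[OF epi] by (simp add: Cvx0_def)
  moreover have "\<phi> x \<le> ereal C" if "norm x < r" for x
    using p that by (intro epi_upper_bound[OF epi]) (auto simp: pinched_def)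
  moreover have "ereal (a * norm x - b) \<le> \<phi> x" for x
  proof (rule ereal_le_epsilon2)
    fix e :: real assume e: "0 < e"
    let ?U = "{z. a * norm x - b - e < a * norm z - b}"
    have "ereal (a * norm x - b - e) \<le> \<phi> x"
    proof (rule epi_eventually_lower_imp[OF epi])
      show "open ?U" by (intro open_Collect_less continuous_intros)
      show "x \<in> ?U" using e by simp
      have "ereal (a * norm x - b - e) \<le> \<phi>s k z" if "z \<in> ?U" for k z
        by (rule order_trans[of _ "ereal (a * norm z - b)"])
          (use p[of k] that in \<open>auto simp: pinched_def\<close>)
      then show "\<forall>\<^sub>F k in sequentially. \<forall>z\<in>?U. ereal (a * norm x - b - e) \<le> \<phi>s k z" by simp
    qed
    then show "ereal (a * norm x - b) \<le> \<phi> x + ereal e" by (cases "\<phi> x") auto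
  qed
  ultimately show ?thesis by (simp add: pinched_def)
qed

lemma even_epi_limit:
  fixes \<phi>s :: "nat \<Rightarrow> 'a::euclidean_space \<Rightarrow> ereal"
  assumes epi: "epi_converges \<phi>s \<phi>" and ev: "\<And>k. even_fun (\<phi>s k)"
  shows "even_fun \<phi>"
proof -
  have le: "\<phi> (- x) \<le> \<phi> x" for x
  proof (rule ccontr)
    assume "\<not> \<phi> (- x) \<le> \<phi> x"
    then have "\<phi> x < \<phi> (- x)" by simp
    then obtain c where c: "\<phi> x < c" "c < \<phi> (- x)" using dense by blast
    obtain U where U: "open U" "- x \<in> U" "\<forall>\<^sub>F k in sequentially. \<forall>z\<in>U. c < \<phi>s k z"
      using epi_lower[OF epi c(2)] by blast
    have "open (uminus ` U)" "x \<in> uminus ` U"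
      using U by (auto intro: open_negations image_eqI[of _ _ "- x"])
    from epi_upper[OF epi c(1) this] U(3)
    have "\<forall>\<^sub>F k in sequentially. False"
      by eventually_elim (use ev in \<open>force simp: even_fun_def\<close>)
    then show False by simp
  qed
  show ?thesis unfolding even_fun_def using le le[of "- x" for x] by (metis add.inverse_inverse order_antisym)
qed

lemma pinched_near_zero:
  assumes p: "pinched a b r C \<phi>" and w: "norm w < r * t" "0 < t" "t \<le> 1"
  shows "\<phi> w \<le> ereal (t * C)"
proof -
  have "\<phi> (t *\<^sub>R ((1 / t) *\<^sub>R w)) \<le> ereal (t * C)"
    using p w unfolding pinched_def by (intro Cvx0_scale_le) (auto simp: field_simps)
  then show ?thesis using w by simp
qed

text \<open>
  A recovery point \<open>z\<close> near \<open>s x\<close> need not lie on the ray through \<open>x\<close>, but \<open>x\<close> is a convex combination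
  of \<open>z\<close> and a point \<open>w\<close> near \<open>0\<close>, and near \<open>0\<close> pinched functions are uniformly small.
\<close>
lemma epi_radial_upper:
  fixes \<phi>s :: "nat \<Rightarrow> 'a::euclidean_space \<Rightarrow> ereal"
  assumes epi: "epi_converges \<phi>s \<phi>" and p: "\<And>k. pinched a b r C (\<phi>s k)"
    and rC: "0 < r" "0 < C" and s: "1 < s" and c: "\<phi> (s *\<^sub>R x) < ereal c"
  shows "\<forall>\<^sub>F k in sequentially. \<phi>s k x \<le> ereal c"
proof -
  have cvx: "\<phi>s k \<in> Cvx0" for k using p[of k] by (simp add: pinched_def)
  have "0 \<le> \<phi> (s *\<^sub>R x)" using pinched_epi_limit[OF epi p] by (auto simp: pinched_def Cvx0_nonneg)
  then have c0: "0 < c" using c by (metis ereal_less(2) le_less_trans)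
  \<comment> \<open>\<open>t\<close> makes \<open>\<phi>\<^sub>k\<close> at most \<open>t * C \<le> c\<close> near \<open>0\<close>; \<open>d\<close> keeps the point \<open>w\<close> below in that region.\<close>
  define t where "t = min 1 (c / C)"
  have t: "0 < t" "t \<le> 1" "t * C \<le> c" using c0 rC by (auto simp: t_def min_def field_simps)
  define d where "d = r * t * (s - 1)"
  have d: "0 < d" using rC t s by (simp add: d_def)
  have "\<forall>\<^sub>F k in sequentially. \<exists>z\<in>ball (s *\<^sub>R x) d. \<phi>s k z < ereal c"
    using d by (intro epi_upper[OF epi c]) auto
  then show ?thesis
  proof eventually_elim
    case (elim k)
    then obtain z where z: "dist (s *\<^sub>R x) z < d" "\<phi>s k z < ereal c" by auto
    define w where "w = (1 / (s - 1)) *\<^sub>R (s *\<^sub>R x - z)"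
    have "norm w < r * t" using z(1) s by (simp add: w_def d_def dist_norm divide_less_eq)
    from pinched_near_zero[OF p this t(1,2)]
    have w: "\<phi>s k w \<le> ereal c" using t(3) by (meson ereal_less_eq(3) order_trans)
    \<comment> \<open>\<open>x = z / s + (1 - 1 / s) w\<close>, with the weights in the form used by \<open>Cvx0_convex_le\<close>\<close>
    have "(1 - (1 - 1 / s)) *\<^sub>R z + (1 - 1 / s) *\<^sub>R w = (1 / s) *\<^sub>R z + ((1 - 1/s) / (s - 1)) *\<^sub>R (s *\<^sub>R x - z)"
      by (simp add: w_def)
    also have "(1 - 1/s) / (s - 1) = 1 / s" using s by (simp add: field_simps)
    also have "(1 / s) *\<^sub>R z + (1 / s) *\<^sub>R (s *\<^sub>R x - z) = x" using s by (simp add: scaleR_diff_right)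
    finally have "x = (1 - (1 - 1 / s)) *\<^sub>R z + (1 - 1 / s) *\<^sub>R w" ..
    moreover have "\<phi>s k ((1 - (1 - 1 / s)) *\<^sub>R z + (1 - 1 / s) *\<^sub>R w)
        \<le> ereal ((1 - (1 - 1 / s)) * c + (1 - 1 / s) * c)"
      using s z(2) w by (intro Cvx0_convex_le cvx) auto
    moreover have "(1 - (1 - 1 / s)) * c + (1 - 1 / s) * c = c" by (simp add: algebra_simps)
    ultimately show ?case by simp
  qed
qed

text \<open>
  A point \<open>x\<close> witnessing \<open>\<A>\<phi> y > c\<close> has a recovery point that witnesses \<open>\<A>\<phi>\<^sub>k y > c\<close>.
\<close>
lemma polarity_epi_lower:
  fixes \<phi>s :: "nat \<Rightarrow> 'a::euclidean_space \<Rightarrow> ereal"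
  assumes epi: "epi_converges \<phi>s \<phi>" and cvx: "\<And>k. \<phi>s k \<in> Cvx0" "\<phi> \<in> Cvx0"
    and c: "0 \<le> c" "ereal c < polarity \<phi> y"
  shows "\<forall>\<^sub>F k in sequentially. ereal c < polarity (\<phi>s k) y"
proof -
  obtain x q where x: "\<phi> x = ereal q" "1 + c * q < x \<bullet> y"
    using less_polarityD[OF cvx(2) c] by blast
  \<comment> \<open>Allowing \<open>\<phi>\<^sub>k\<close> to exceed \<open>\<phi> x\<close> by \<open>e\<close> uses up at most half of the slack \<open>2 * D\<close>.\<close>
  define D where "D = (x \<bullet> y - 1 - c * q) / 2"
  define e where "e = D / (c + 1)"
  have c1: "c + 1 \<noteq> 0" using c by simp
  have e: "0 < e" using x c by (simp add: e_def D_def)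
  have e2: "(c + 1) * e = D" using c1 by (simp add: e_def)
  have ce: "1 + c * (q + e) < x \<bullet> y" 
  proof -
    have "c * e \<le> (c + 1) * e" using e by (simp add: algebra_simps)
    then show ?thesis using x(2) e2 by (simp add: D_def algebra_simps)
  qed
  have "\<forall>\<^sub>F k in sequentially. \<exists>z\<in>{z. 1 + c * (q + e) < z \<bullet> y}. \<phi>s k z < ereal (q + e)"
    using x ce e by (intro epi_upper[OF epi, of x] open_Collect_less continuous_intros) auto
  then show ?thesis
  proof eventually_elim
    case (elim k)
    then show ?case using less_polarityI[OF cvx(1) c(1)] less_imp_le by blast
  qed
qed

text \<open>
  Finitely many of the neighbourhoods cover the compact set, and finitely many conditions that each
  hold eventually hold eventually together.
\<close>
lemma eventually_uniform_on_compact: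
  assumes K: "compact K"
    and loc: "\<And>x. x \<in> K \<Longrightarrow> \<exists>U. open U \<and> x \<in> U \<and> (\<forall>\<^sub>F k in F. \<forall>z\<in>U. P k z)"
  shows "\<forall>\<^sub>F k in F. \<forall>z\<in>K. P k z"
proof -
  obtain U where U: "\<And>x. x \<in> K \<Longrightarrow> open (U x) \<and> x \<in> U x \<and> (\<forall>\<^sub>F k in F. \<forall>z\<in>U x. P k z)"
    using loc by metis
  obtain D where D: "D \<subseteq> K" "finite D" "K \<subseteq> (\<Union>x\<in>D. U x)"
    using compactE_image[OF K, of K U] U by blast
  have "\<forall>\<^sub>F k in F. \<forall>x\<in>D. \<forall>z\<in>U x. P k z"
    using D U by (intro eventually_ball_finite) auto
  then show ?thesis by eventually_elim (use D in blast)
qed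

text \<open>
  By \<open>polarity_le_iff\<close>, the inequality \<open>x \<bullet> y - 1 \<le> c * \<phi>\<^sub>k x\<close> has to hold for all \<open>x\<close> at once when \<open>k\<close> is
  large. On a ball it follows by compactness, as dilating \<open>y\<close> by \<open>s > 1\<close> leaves room in the limiting
  inequality at each point. Outside the ball compactness is of no help; but on a sphere so large that
  \<open>c * \<phi>\<close> exceeds \<open>1 / (s - 1)\<close>, even the homogeneous inequality \<open>x \<bullet> y \<le> c * \<phi>\<^sub>k x\<close> holds, and convexity
  propagates that one along rays to infinity.
\<close>
lemma polarity_epi_upper:
  fixes \<phi>s :: "nat \<Rightarrow> 'a::euclidean_space \<Rightarrow> ereal"
  assumes epi: "epi_converges \<phi>s \<phi>" and p: "\<And>k. pinched a b r C (\<phi>s k)"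
    and a: "0 < a" and s: "1 < s" and c: "polarity \<phi> (s *\<^sub>R y) < ereal c"
  shows "\<forall>\<^sub>F k in sequentially. polarity (\<phi>s k) y \<le> ereal c"
proof -
  have cvx: "\<phi>s k \<in> Cvx0" for k using p[of k] by (simp add: pinched_def)
  have p\<phi>: "pinched a b r C \<phi>" by (rule pinched_epi_limit[OF epi p])
  then have cvx\<phi>: "\<phi> \<in> Cvx0" by (simp add: pinched_def)
  have c0: "0 < c" using polarity_nonneg[OF cvx\<phi>] c by (metis ereal_less(2) le_less_trans)
  have pol: "s * (x \<bullet> y) \<le> 1 + c * q" if "\<phi> x = ereal q" for x q
    using polarity_le_iff[OF cvx\<phi>, of c "s *\<^sub>R y"] c c0 that by auto
  \<comment> \<open>A strict inequality in the limit holds, non-strictly, near the point for all large \<open>k\<close>;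
  it is used with \<open>\<delta> = 1\<close> on the ball and with \<open>\<delta> = 0\<close> on the sphere.\<close>
  have lift: "\<exists>U. open U \<and> x \<in> U \<and> (\<forall>\<^sub>F k in sequentially. \<forall>z\<in>U. \<forall>q. \<phi>s k z = ereal q \<longrightarrow> z \<bullet> y - \<delta> \<le> c * q)"
    if x: "\<And>q. \<phi> x = ereal q \<Longrightarrow> x \<bullet> y - \<delta> < c * q" for x \<delta>
  proof -
    have "ereal ((x \<bullet> y - \<delta>) / c) < \<phi> x"
      using x c0 Cvx0_nonneg[OF cvx\<phi>, of x] by (cases "\<phi> x") (auto simp: field_simps)
    then obtain d where d: "ereal ((x \<bullet> y - \<delta>) / c) < d" "d < \<phi> x" using dense by blast
    then obtain d' where d': "d = ereal d'" by (cases d) auto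
    obtain U where U: "open U" "x \<in> U" "\<forall>\<^sub>F k in sequentially. \<forall>z\<in>U. d < \<phi>s k z"
      using epi_lower[OF epi d(2)] by blast
    let ?U = "U \<inter> {z. z \<bullet> y - \<delta> < c * d'}"
    have "open ?U" using U by (intro open_Int open_Collect_less continuous_intros) auto
    moreover have "x \<in> ?U" using U d d' c0 by (auto simp: field_simps)
    moreover have "\<forall>\<^sub>F k in sequentially. \<forall>z\<in>?U. \<forall>q. \<phi>s k z = ereal q \<longrightarrow> z \<bullet> y - \<delta> \<le> c * q"
      using U(3)
    proof eventually_elim
      case (elim k)
      show ?case
      proof (intro ballI allI impI)
        fix z q assume z: "z \<in> ?U" "\<phi>s k z = ereal q"
        then have "d' < q" using elim d' by force
        then have "c * d' < c * q" using c0 by simp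
        then show "z \<bullet> y - \<delta> \<le> c * q" using z(1) by simp
      qed
    qed
    ultimately show ?thesis by blast
  qed
  define R where "R = (1 + \<bar>b\<bar> + 1 / ((s - 1) * c)) / a"
  have R': "(s - 1) * c * (a * R - b) > 1"
  proof -
    have "1 + 1 / ((s - 1) * c) \<le> a * R - b" using a by (simp add: R_def)
    then have "(s - 1) * c * (1 + 1 / ((s - 1) * c)) \<le> (s - 1) * c * (a * R - b)"
      using s c0 by (intro mult_left_mono) auto
    moreover have "(s - 1) * c * (1 + 1 / ((s - 1) * c)) = (s - 1) * c + 1"
      using s c0 by (simp add: field_simps)
    moreover have "0 < (s - 1) * c" using s c0 by simp
    ultimately show ?thesis by linarith
  qed
  have R: "0 < R" using a s c0 by (auto simp: R_def intro!: divide_pos_pos add_pos_pos add_pos_nonneg)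
  have ball: "\<forall>\<^sub>F k in sequentially. \<forall>x\<in>cball 0 R. \<forall>q. \<phi>s k x = ereal q \<longrightarrow> x \<bullet> y - 1 \<le> c * q"
  proof (rule eventually_uniform_on_compact[OF compact_cball])
    fix x
    show "\<exists>U. open U \<and> x \<in> U \<and> (\<forall>\<^sub>F k in sequentially. \<forall>z\<in>U. \<forall>q. \<phi>s k z = ereal q \<longrightarrow> z \<bullet> y - 1 \<le> c * q)"
    proof (cases "x \<bullet> y < 1")
      case True
      have "open {z. z \<bullet> y < 1}" by (intro open_Collect_less continuous_intros)
      moreover have "z \<bullet> y - 1 \<le> c * q" if "z \<bullet> y < 1" "\<phi>s k z = ereal q" for z k q
      proof -
        have "0 \<le> q" using that Cvx0_nonneg[OF cvx, of k z] by simp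
        then have "0 \<le> c * q" using c0 by simp
        then show ?thesis using that by linarith
      qed
      ultimately show ?thesis using True by (intro exI[of _ "{z. z \<bullet> y < 1}"]) auto
    next
      case False
      then have "1 * (x \<bullet> y) < s * (x \<bullet> y)" using s by (intro mult_strict_right_mono) auto
      then show ?thesis using pol[of x] by (intro lift) force
    qed
  qed
  have sphere: "\<forall>\<^sub>F k in sequentially. \<forall>x\<in>sphere 0 R. \<forall>q. \<phi>s k x = ereal q \<longrightarrow> x \<bullet> y - 0 \<le> c * q"
  proof (rule eventually_uniform_on_compact[OF compact_sphere])
    fix x assume x: "x \<in> sphere (0::'a) R"
    show "\<exists>U. open U \<and> x \<in> U \<and> (\<forall>\<^sub>F k in sequentially. \<forall>z\<in>U. \<forall>q. \<phi>s k z = ereal q \<longrightarrow> z \<bullet> y - 0 \<le> c * q)"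
    proof (rule lift)
      fix q assume q: "\<phi> x = ereal q"
      have "a * R - b \<le> q" using p\<phi> x q by (auto simp: pinched_def dest: spec[of _ x])
      then have "(s - 1) * c * (a * R - b) \<le> (s - 1) * c * q" using s c0 by simp
      then have "1 < (s - 1) * c * q" using R' by linarith
      then have "s * (x \<bullet> y) < s * (c * q)" using pol[OF q] by (simp add: algebra_simps)
      then show "x \<bullet> y - 0 < c * q" using s by simp
    qed
  qed
  from ball sphere show ?thesis
  proof eventually_elim
    case (elim k)
    have "x \<bullet> y \<le> 1 + c * q" if q: "\<phi>s k x = ereal q" for x q
    proof (cases "norm x \<le> R")
      case True
      then show ?thesis using elim(1) q by force
    next
      case False
        define t where "t = R / norm x"
        have t: "0 < t" "t \<le> 1" using R False less_trans[of 0 R "norm x"] by (simp_all add: t_def not_le)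
        have nt: "norm (t *\<^sub>R x) = R" using R False by (cases "x = 0") (simp_all add: t_def)
        have "\<phi>s k (t *\<^sub>R x) \<le> ereal (t * q)" using t q by (intro Cvx0_scale_le cvx) auto
        then obtain q' where q': "\<phi>s k (t *\<^sub>R x) = ereal q'" "q' \<le> t * q"
          using Cvx0_nonneg[OF cvx, of k "t *\<^sub>R x"] by (cases "\<phi>s k (t *\<^sub>R x)") auto
        have "t * (x \<bullet> y) \<le> c * q'" using elim(2) nt q' by (force simp: inner_simps)
        also have "\<dots> \<le> t * (c * q)" using q' c0 by (simp add: mult.left_commute)
        finally have "x \<bullet> y \<le> c * q" using t by simp
        then show ?thesis by simp
    qed
    then show ?case using polarity_le_iff[OF cvx, of c k y] c0 by simp
  qed
qed

section \<open>Linear growth and integrability\<close>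

lemma power_le_fact_exp:
  fixes y :: real
  assumes "0 \<le> y"
  shows "y ^ n \<le> fact n * exp y"
proof -
  have "(\<Sum>i\<in>{n}. y ^ i /\<^sub>R fact i) \<le> (\<Sum>i. y ^ i /\<^sub>R fact i)"
    using assms by (intro sum_le_suminf summable_exp_generic) auto
  then show ?thesis by (simp add: exp_def field_simps)
qed

text \<open>
  Compare with \<open>\<Sum>k. exp (b - a k) * vol (ball 0 (k + 1))\<close>; the polynomial growth of the volumes is
  absorbed by half of the exponential decay.
\<close>
lemma nn_integral_exp_norm_finite:
  assumes a: "0 < a"
  shows "(\<integral>\<^sup>+ x. ennreal (exp (b - a * norm (x::'a::euclidean_space))) \<partial>lborel) < \<infinity>"
proof -
  let ?n = "DIM('a)"
  let ?B = "\<lambda>k::nat. ball (0::'a) (real k + 1)"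
  let ?V = "unit_ball_vol (real ?n)"
  define K where "K = exp b * ?V * fact ?n * (2 / a) ^ ?n * exp (a / 2)"
  have sup: "ennreal (exp (b - a * norm x)) \<le> (\<Sum>k. ennreal (exp (b - a * real k)) * indicator (?B k) x)" for x :: 'a
  proof -
    define k where "k = nat \<lfloor>norm x\<rfloor>"
    have k: "real k \<le> norm x" "norm x < real k + 1" unfolding k_def by (auto simp: of_nat_nat)
    have "ennreal (exp (b - a * norm x)) \<le> ennreal (exp (b - a * real k)) * indicator (?B k) x"
      using k a by (auto simp: indicator_def)
    also have "\<dots> = (\<Sum>i\<in>{k}. ennreal (exp (b - a * real i)) * indicator (?B i) x)"
      by (subst sum.insert) auto
    also have "\<dots> \<le> (\<Sum>k. ennreal (exp (b - a * real k)) * indicator (?B k) x)"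
      by (rule sum_le_suminf) auto
    finally show ?thesis .
  qed
  have term_le: "exp (b - a * real k) * (?V * (real k + 1) ^ ?n) \<le> K * exp (- (a / 2)) ^ k" for k
  proof -
    have "(real k + 1) ^ ?n = (2 / a) ^ ?n * (a / 2 * (real k + 1)) ^ ?n"
      unfolding power_mult_distrib[symmetric] using a by (intro arg_cong[of _ _ "\<lambda>u. u ^ DIM('a)"]) simp
    also have "\<dots> \<le> (2 / a) ^ ?n * (fact ?n * exp (a / 2 * (real k + 1)))"
      using a by (intro mult_left_mono power_le_fact_exp) auto
    finally have "exp (b - a * real k) * (?V * (real k + 1) ^ ?n)
        \<le> exp (b - a * real k) * (?V * ((2 / a) ^ ?n * (fact ?n * exp (a / 2 * (real k + 1)))))"
      by (intro mult_left_mono) auto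
    also have "\<dots> = ?V * ((2 / a) ^ ?n * fact ?n) * (exp (b - a * real k) * exp (a / 2 * (real k + 1)))"
      by (simp only: mult_ac)
    also have "exp (b - a * real k) * exp (a / 2 * (real k + 1)) = exp b * exp (a / 2) * exp (- (a / 2)) ^ k"
      by (simp add: exp_add[symmetric] exp_of_nat_mult[symmetric] algebra_simps)
    finally show ?thesis by (simp add: K_def mult_ac)
  qed
  have "(\<integral>\<^sup>+ x. ennreal (exp (b - a * norm (x::'a))) \<partial>lborel)
      \<le> (\<integral>\<^sup>+ x. (\<Sum>k. ennreal (exp (b - a * real k)) * indicator (?B k) x) \<partial>lborel)"
    by (intro nn_integral_mono sup)
  also have "\<dots> = (\<Sum>k. \<integral>\<^sup>+ x. ennreal (exp (b - a * real k)) * indicator (?B k) x \<partial>lborel)"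
    by (intro nn_integral_suminf borel_measurable_times_ennreal borel_measurable_const borel_measurable_indicator) auto
  also have "\<dots> = (\<Sum>k. ennreal (exp (b - a * real k) * (?V * (real k + 1) ^ ?n)))"
    by (intro suminf_cong, subst nn_integral_cmult_indicator)
       (auto simp: emeasure_ball ennreal_mult')
  also have "\<dots> \<le> (\<Sum>k. ennreal (K * exp (- (a / 2)) ^ k))"
    by (intro suminf_le ennreal_leI term_le) auto
  also have "\<dots> < \<infinity>"
  proof -
    have "K \<ge> 0" using a by (simp add: K_def)
    moreover have "summable (\<lambda>k. K * exp (- (a / 2)) ^ k)"
      using a by (intro summable_mult summable_geometric) simp
    ultimately show ?thesis using ennreal_suminf_neq_top by (auto simp: less_top)
  qed
  finally show ?thesis .
qed

lemma integrable_exp_norm: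
  assumes a: "0 < a"
  shows "integrable lborel (\<lambda>x::'a::euclidean_space. exp (b - a * norm x))"
  using nn_integral_exp_norm_finite[OF a, of b, where 'a='a]
  by (intro integrableI_bounded) auto

lemma integrable_norm_exp_norm:
  assumes a: "0 < a"
  shows "integrable lborel (\<lambda>x::'a::euclidean_space. norm x * exp (b - a * norm x))"
proof (rule Bochner_Integration.integrable_bound)
  show "integrable lborel (\<lambda>x::'a. (2 / a) * exp (b - (a / 2) * norm x))"
    using a by (intro integrable_mult_right integrable_exp_norm) simp
  have "norm x * exp (b - a * norm x) \<le> (2 / a) * exp (b - (a / 2) * norm x)" for x :: 'a
  proof -
    have "a / 2 * norm x \<le> exp (a / 2 * norm x)" using power_le_fact_exp[of "a / 2 * norm x" 1] a by simp
    then have "norm x \<le> (2 / a) * exp (a / 2 * norm x)" using a by (simp add: field_simps)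
    then have "norm x * exp (b - a * norm x) \<le> (2 / a) * exp (a / 2 * norm x) * exp (b - a * norm x)"
      by (rule mult_right_mono) simp
    also have "\<dots> = (2 / a) * exp (b - (a / 2) * norm x)" by (simp add: mult.assoc flip: exp_add)
    finally show ?thesis .
  qed
  then show "AE x::'a in lborel. norm (norm x * exp (b - a * norm x)) \<le> norm ((2 / a) * exp (b - (a / 2) * norm x))"
    using a by (intro AE_I2) simp
qed simp

lemma exp_neg_growth_bound:
  assumes "ereal u \<le> t"
  shows "exp_neg t \<le> exp (- u)"
  using assms by (cases t) auto

lemma integral_exp_neg_finite:
  assumes a: "0 < a" and growth: "\<And>x::'a::euclidean_space. ereal (a * norm x - b) \<le> \<psi> x"
  shows "integral_exp_neg \<psi> < \<infinity>"
proof -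
  have "integral_exp_neg \<psi> \<le> (\<integral>\<^sup>+ x. ennreal (exp (b - a * norm (x::'a))) \<partial>lborel)"
    unfolding integral_exp_neg_def
    using exp_neg_growth_bound[OF growth] by (intro nn_integral_mono ennreal_leI) simp
  then show ?thesis using nn_integral_exp_norm_finite[OF a, of b, where 'a='a] by (simp add: le_less_trans)
qed

lemma nn_integral_scale:
  fixes F :: "'a::euclidean_space \<Rightarrow> ennreal"
  assumes [measurable]: "F \<in> borel_measurable borel" and s: "0 < s"
  shows "(\<integral>\<^sup>+ x. F x \<partial>lborel) = ennreal (s ^ DIM('a)) * (\<integral>\<^sup>+ x. F (s *\<^sub>R x) \<partial>lborel)"
proof -
  have "(\<integral>\<^sup>+ x. F x \<partial>lborel)
      = (\<integral>\<^sup>+ x. F x \<partial>density (distr lborel borel (\<lambda>x. 0 + s *\<^sub>R x)) (\<lambda>_. ennreal (\<bar>s\<bar> ^ DIM('a))))"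
    using s by (subst lborel_affine[of s 0]) auto
  also have "\<dots> = (\<integral>\<^sup>+ x. ennreal (s ^ DIM('a)) * F (s *\<^sub>R x) \<partial>lborel)"
    using s by (subst nn_integral_density) (auto simp: nn_integral_distr)
  also have "\<dots> = ennreal (s ^ DIM('a)) * (\<integral>\<^sup>+ x. F (s *\<^sub>R x) \<partial>lborel)"
    by (intro nn_integral_cmult) measurable
  finally show ?thesis .
qed

section \<open>Almost everywhere convergence of radially increasing functions\<close>

text \<open>
  The dilates \<open>x \<mapsto> F (s x)\<close> increase as \<open>s\<close> decreases to \<open>1\<close>, their limit is at most \<open>F\<close>, and their
  integrals \<open>s\<^sup>-\<^sup>n \<integral>F\<close> tend to \<open>\<integral>F\<close>. Hence the limit agrees with \<open>F\<close> almost everywhere. For \<open>F = exp (- \<phi>)\<close>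
  with \<open>\<phi>\<close> convex this replaces an argument that their domains have negligible boundary; moreover it
  applies to a function and its polar alike.
\<close>
lemma radially_decreasing_AE_regular:
  fixes F :: "'a::euclidean_space \<Rightarrow> ennreal"
  assumes F [measurable]: "F \<in> borel_measurable borel"
    and fin: "(\<integral>\<^sup>+ x. F x \<partial>lborel) < \<infinity>"
    and mono: "\<And>x s. 1 \<le> s \<Longrightarrow> F (s *\<^sub>R x) \<le> F x"
  shows "AE x in lborel. (SUP j::nat. F ((1 + 1 / real (Suc j)) *\<^sub>R x)) = F x"
proof -
  define s where "s j = 1 + 1 / real (Suc j)" for j :: nat
  have s1: "1 \<le> s j" for j by (simp add: s_def)
  have anti: "s j \<le> s i" if "i \<le> j" for i j using that by (simp add: s_def frac_le)
  let ?H = "\<lambda>x. SUP j::nat. F (s j *\<^sub>R x)"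
  have le: "?H x \<le> F x" for x by (intro SUP_least mono s1)
  have inc: "incseq (\<lambda>j x. F (s j *\<^sub>R x))"
  proof (intro incseq_SucI le_funI)
    fix j x
    have "F ((s j / s (Suc j)) *\<^sub>R (s (Suc j) *\<^sub>R x)) \<le> F (s (Suc j) *\<^sub>R x)"
      using anti[of j "Suc j"] s1[of "Suc j"] by (intro mono) (simp add: field_simps)
    moreover have "(s j / s (Suc j)) *\<^sub>R (s (Suc j) *\<^sub>R x) = s j *\<^sub>R x"
      using s1[of "Suc j"] by simp
    ultimately show "F (s j *\<^sub>R x) \<le> F (s (Suc j) *\<^sub>R x)" by metis
  qed
  have H: "(\<integral>\<^sup>+ x. ?H x \<partial>lborel) = (SUP j. \<integral>\<^sup>+ x. F (s j *\<^sub>R x) \<partial>lborel)"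
    by (intro nn_integral_monotone_convergence_SUP inc) measurable
  have eq: "ennreal (s j ^ DIM('a)) * (\<integral>\<^sup>+ x. F (s j *\<^sub>R x) \<partial>lborel) = (\<integral>\<^sup>+ x. F x \<partial>lborel)" for j
    using nn_integral_scale[OF F, of "s j"] s1[of j] by simp
  have "(\<integral>\<^sup>+ x. F x \<partial>lborel) \<le> (\<integral>\<^sup>+ x. ?H x \<partial>lborel)"
  proof (rule LIMSEQ_le_const)
    have "(\<lambda>j. s j ^ DIM('a)) \<longlonglongrightarrow> (1 + 0) ^ DIM('a)"
      unfolding s_def by (intro tendsto_power tendsto_add tendsto_const LIMSEQ_Suc[OF lim_1_over_n])
    then have "(\<lambda>j. ennreal (s j ^ DIM('a))) \<longlonglongrightarrow> ennreal 1" by (intro tendsto_ennrealI) simp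
    then have "(\<lambda>j. ennreal (s j ^ DIM('a)) * (\<integral>\<^sup>+ x. ?H x \<partial>lborel)) \<longlonglongrightarrow> ennreal 1 * (\<integral>\<^sup>+ x. ?H x \<partial>lborel)"
      by (intro tendsto_mult_ennreal tendsto_const) auto
    then show "(\<lambda>j. ennreal (s j ^ DIM('a)) * (\<integral>\<^sup>+ x. ?H x \<partial>lborel)) \<longlonglongrightarrow> (\<integral>\<^sup>+ x. ?H x \<partial>lborel)" by simp
    have "(\<integral>\<^sup>+ x. F x \<partial>lborel) \<le> ennreal (s j ^ DIM('a)) * (\<integral>\<^sup>+ x. ?H x \<partial>lborel)" for j
      unfolding eq[of j, symmetric] by (intro mult_left_mono nn_integral_mono SUP_upper) auto
    then show "\<exists>N. \<forall>n\<ge>N. (\<integral>\<^sup>+ x. F x \<partial>lborel) \<le> ennreal (s n ^ DIM('a)) * (\<integral>\<^sup>+ x. ?H x \<partial>lborel)" by blast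
  qed
  moreover have "(\<integral>\<^sup>+ x. ?H x \<partial>lborel) \<le> (\<integral>\<^sup>+ x. F x \<partial>lborel)" by (intro nn_integral_mono le)
  ultimately have eqH: "(\<integral>\<^sup>+ x. ?H x \<partial>lborel) = (\<integral>\<^sup>+ x. F x \<partial>lborel)" by (rule antisym[rotated])
  have "(\<integral>\<^sup>+ x. F x - ?H x \<partial>lborel) = (\<integral>\<^sup>+ x. F x \<partial>lborel) - (\<integral>\<^sup>+ x. ?H x \<partial>lborel)"
    using fin eqH le by (intro nn_integral_diff) auto
  also have "\<dots> = 0" using eqH fin by (simp add: less_top)
  finally have "AE x in lborel. F x - ?H x = 0"
    by (subst (asm) nn_integral_0_iff_AE) measurable
  then show ?thesis
  proof eventually_elim
    case (elim x)
    then have "F x \<le> ?H x" by (metis diff_eq_0_iff_ennreal not_le)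
    then show ?case using le[of x] by (simp add: s_def antisym)
  qed
qed

text \<open>
  The upper estimate compares \<open>\<psi>\<^sub>k x\<close> with the value of \<open>\<psi>\<close> at a dilated point, so it gives convergence
  exactly where \<open>\<psi>\<close> is continuous from outside along the ray.
\<close>
lemma exp_neg_AE_convergence:
  fixes \<psi> :: "'a::euclidean_space \<Rightarrow> ereal"
  assumes meas: "\<psi> \<in> borel_measurable borel" and fin: "integral_exp_neg \<psi> < \<infinity>"
    and nonneg: "\<And>x. 0 \<le> \<psi> x" "\<And>k x. 0 \<le> \<psi>s k x"
    and mono: "\<And>x s. 1 \<le> s \<Longrightarrow> \<psi> x \<le> \<psi> (s *\<^sub>R x)"
    and lower: "\<And>x c. 0 \<le> c \<Longrightarrow> ereal c < \<psi> x \<Longrightarrow> \<forall>\<^sub>F k in sequentially. ereal c < \<psi>s k x"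
    and upper: "\<And>x c s. 1 < s \<Longrightarrow> \<psi> (s *\<^sub>R x) < ereal c \<Longrightarrow> \<forall>\<^sub>F k in sequentially. \<psi>s k x \<le> ereal c"
  shows "AE x in lborel. (\<lambda>k. exp_neg (\<psi>s k x)) \<longlonglongrightarrow> exp_neg (\<psi> x)"
proof -
  let ?F = "\<lambda>x. ennreal (exp_neg (\<psi> x))"
  have "AE x in lborel. (SUP j::nat. ?F ((1 + 1 / real (Suc j)) *\<^sub>R x)) = ?F x"
    using fin meas nonneg mono exp_neg_measurable_comp[OF meas]
    by (intro radially_decreasing_AE_regular)
       (auto simp: integral_exp_neg_def intro!: ennreal_leI exp_neg_antimono)
  then show ?thesis
  proof eventually_elim
    case (elim x)
    have "(\<lambda>k. \<psi>s k x) \<longlonglongrightarrow> \<psi> x"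
    proof (rule order_tendstoI)
      fix d assume d: "d < \<psi> x"
      show "\<forall>\<^sub>F k in sequentially. d < \<psi>s k x"
      proof (cases "d < 0")
        case True
        then show ?thesis using nonneg(2) less_le_trans by (intro always_eventually) blast
      next
        case False
        then obtain c where "d = ereal c" "0 \<le> c" using d by (cases d) auto
        then show ?thesis using lower d by simp
      qed
    next
      fix d assume "\<psi> x < d"
      then obtain c where c: "\<psi> x < ereal c" "ereal c < d" using ereal_dense2 by blast
      have "exp_neg (ereal c) < exp_neg (\<psi> x)" using c nonneg by (intro exp_neg_strict_antimono) auto
      then have "ennreal (exp_neg (ereal c)) < (SUP j::nat. ?F ((1 + 1 / real (Suc j)) *\<^sub>R x))"
        unfolding elim by (intro ennreal_lessI) (use le_less_trans[OF exp_neg_nonneg] in blast)+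
      then obtain j :: nat where
        "ennreal (exp_neg (ereal c)) < ?F ((1 + 1 / real (Suc j)) *\<^sub>R x)"
        unfolding less_SUP_iff by blast
      then have "exp_neg (ereal c) < exp_neg (\<psi> ((1 + 1 / real (Suc j)) *\<^sub>R x))"
        by (subst (asm) ennreal_less_iff) auto
      moreover have "0 \<le> ereal c" using le_less_trans[OF nonneg(1) c(1)] by simp
      ultimately have "\<psi> ((1 + 1 / real (Suc j)) *\<^sub>R x) < ereal c"
        using exp_neg_antimono by (meson not_le)
      then have "\<forall>\<^sub>F k in sequentially. \<psi>s k x \<le> ereal c" by (intro upper) auto
      then show "\<forall>\<^sub>F k in sequentially. \<psi>s k x < d" by eventually_elim (use c in auto)
    qed
    then show ?case using nonneg by (intro tendsto_exp_neg) auto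
  qed
qed

lemma integral_exp_neg_convergence:
  fixes \<psi> :: "'a::euclidean_space \<Rightarrow> ereal"
  assumes meas: "\<psi> \<in> borel_measurable borel" "\<And>k. \<psi>s k \<in> borel_measurable borel"
    and a: "0 < a" and growth: "\<And>k x. ereal (a * norm x - b) \<le> \<psi>s k x"
    and lim: "AE x in lborel. (\<lambda>k. exp_neg (\<psi>s k x)) \<longlonglongrightarrow> exp_neg (\<psi> x)"
  shows "(\<lambda>k. integral_exp_neg (\<psi>s k)) \<longlonglongrightarrow> integral_exp_neg \<psi>"
  unfolding integral_exp_neg_def
proof (rule nn_integral_dominated_convergence[where w = "\<lambda>x. ennreal (exp (b - a * norm x))"])
  show "AE x in lborel. ennreal (exp_neg (\<psi>s k x)) \<le> ennreal (exp (b - a * norm x))" for k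
    using exp_neg_growth_bound[OF growth] by (intro AE_I2 ennreal_leI) simp
  show "AE x in lborel. (\<lambda>k. ennreal (exp_neg (\<psi>s k x))) \<longlonglongrightarrow> ennreal (exp_neg (\<psi> x))"
    using lim by eventually_elim (rule tendsto_ennrealI)
qed (use nn_integral_exp_norm_finite[OF a] exp_neg_measurable_comp[OF meas(1)]
      exp_neg_measurable_comp[OF meas(2)] in \<open>auto simp: less_top\<close>)

lemma first_moment_integrable:
  fixes \<psi> :: "'a::euclidean_space \<Rightarrow> ereal"
  assumes meas: "\<psi> \<in> borel_measurable borel" and a: "0 < a"
    and growth: "\<And>x. ereal (a * norm x - b) \<le> \<psi> x"
  shows "integrable lborel (\<lambda>x. exp_neg (\<psi> x) *\<^sub>R x)"
proof (rule Bochner_Integration.integrable_bound[OF integrable_norm_exp_norm[OF a, of b]])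
  show "(\<lambda>x. exp_neg (\<psi> x) *\<^sub>R x) \<in> borel_measurable lborel"
    using exp_neg_measurable_comp[OF meas] by measurable
  show "AE x in lborel. norm (exp_neg (\<psi> x) *\<^sub>R x) \<le> norm (norm x * exp (b - a * norm x))"
    using exp_neg_growth_bound[OF growth]
    by (intro AE_I2) (auto simp: abs_mult mult.commute[of "norm _"] intro!: mult_right_mono)
qed

lemma first_moment_convergence:
  fixes \<psi> :: "'a::euclidean_space \<Rightarrow> ereal"
  assumes meas: "\<psi> \<in> borel_measurable borel" "\<And>k. \<psi>s k \<in> borel_measurable borel"
    and a: "0 < a" and growth: "\<And>k x. ereal (a * norm x - b) \<le> \<psi>s k x"
    and lim: "AE x in lborel. (\<lambda>k. exp_neg (\<psi>s k x)) \<longlonglongrightarrow> exp_neg (\<psi> x)"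
  shows "(\<lambda>k. \<integral>x. exp_neg (\<psi>s k x) *\<^sub>R x \<partial>lborel) \<longlonglongrightarrow> (\<integral>x. exp_neg (\<psi> x) *\<^sub>R x \<partial>lborel)"
proof (rule integral_dominated_convergence[where w = "\<lambda>x. norm x * exp (b - a * norm x)"])
  show "AE x in lborel. norm (exp_neg (\<psi>s k x) *\<^sub>R x) \<le> norm x * exp (b - a * norm x)" for k
    using exp_neg_growth_bound[OF growth]
    by (intro AE_I2) (auto simp: mult.commute[of "norm _"] intro!: mult_right_mono)
  show "AE x in lborel. (\<lambda>k. exp_neg (\<psi>s k x) *\<^sub>R x) \<longlonglongrightarrow> exp_neg (\<psi> x) *\<^sub>R x"
    using lim by eventually_elim (intro tendsto_scaleR tendsto_const)
qed (use integrable_norm_exp_norm[OF a] exp_neg_measurable_comp[OF meas(1)]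
      exp_neg_measurable_comp[OF meas(2)] in auto)

lemma integral_exp_neg_eq_integral:
  fixes \<phi> :: "'a::euclidean_space \<Rightarrow> ereal"
  assumes \<phi>: "\<phi> \<in> Cvx0" and fin: "integral_exp_neg \<phi> < \<infinity>"
  shows "integrable lborel (\<lambda>x. exp_neg (\<phi> x))"
    and "integral_exp_neg \<phi> = ennreal (\<integral>x. exp_neg (\<phi> x) \<partial>lborel)"
proof -
  have [measurable]: "(\<lambda>x. exp_neg (\<phi> x)) \<in> borel_measurable lborel"
    using exp_neg_measurable_comp[OF Cvx0_measurable[OF \<phi>]] by simp
  show int: "integrable lborel (\<lambda>x. exp_neg (\<phi> x))"
    using fin unfolding integral_exp_neg_def by (intro integrableI_bounded) auto
  show "integral_exp_neg \<phi> = ennreal (\<integral>x. exp_neg (\<phi> x) \<partial>lborel)"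
    unfolding integral_exp_neg_def using int by (intro nn_integral_eq_integral) auto
qed

lemma centroid_eq_0_iff:
  fixes \<phi> :: "'a::euclidean_space \<Rightarrow> ereal"
  assumes \<phi>: "\<phi> \<in> Cvx0_plus"
  shows "centroid \<phi> = 0 \<longleftrightarrow> (\<integral>x. exp_neg (\<phi> x) *\<^sub>R x \<partial>lborel) = 0"
proof -
  have "(\<integral>x. exp_neg (\<phi> x) \<partial>lborel) \<noteq> 0"
    using \<phi> integral_exp_neg_eq_integral(2)[of \<phi>] by (auto simp: Cvx0_plus_def)
  then show ?thesis by (simp add: centroid_def)
qed

section \<open>Continuity on pinched functions and the direct method\<close>

lemma pinched_Cvx0_plus:
  fixes \<phi> :: "'a::euclidean_space \<Rightarrow> ereal"
  assumes p: "pinched a b r C \<phi>" and pos: "0 < a" "0 < r"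
  shows "\<phi> \<in> Cvx0_plus"
proof -
  have "integral_exp_neg \<phi> < \<infinity>" using p pos by (intro integral_exp_neg_finite[of a b]) (auto simp: pinched_def)
  moreover have "0 < integral_exp_neg \<phi>"
  proof -
    have "0 < ennreal (exp (- C)) * emeasure lborel (ball (0::'a) r)"
      using pos by (simp add: emeasure_ball ennreal_zero_less_mult_iff)
    also have "\<dots> = (\<integral>\<^sup>+ x. ennreal (exp (- C)) * indicator (ball (0::'a) r) x \<partial>lborel)"
      by (subst nn_integral_cmult_indicator) auto
    also have "\<dots> \<le> integral_exp_neg \<phi>"
      unfolding integral_exp_neg_def
    proof (intro nn_integral_mono)
      fix x :: 'a
      show "ennreal (exp (- C)) * indicator (ball 0 r) x \<le> ennreal (exp_neg (\<phi> x))"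
      proof (cases "norm x < r")
        case True
        then have "exp_neg (ereal C) \<le> exp_neg (\<phi> x)"
          using p by (intro exp_neg_antimono) (auto simp: pinched_def Cvx0_nonneg)
        then show ?thesis using True by (simp add: ennreal_leI)
      qed simp
    qed
    finally show ?thesis .
  qed
  ultimately show ?thesis using p by (simp add: Cvx0_plus_def pinched_def)
qed

lemma pinched_polarity_finite:
  fixes \<phi> :: "'a::euclidean_space \<Rightarrow> ereal"
  assumes p: "pinched a b r C \<phi>" and pos: "0 < r" "0 < C"
  shows "integral_exp_neg (polarity \<phi>) < \<infinity>"
  using p pos polarity_linear_growth[of \<phi> r C]
  by (intro integral_exp_neg_finite[of "r / (2 * C)" "1 / C"]) (auto simp: pinched_def)

lemma pinched_limit:
  fixes \<phi> :: "'a::euclidean_space \<Rightarrow> ereal"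
  assumes epi: "epi_converges \<phi>s \<phi>" and p: "\<And>k. pinched a b r C (\<phi>s k)"
    and pos: "0 < a" "0 < r" "0 < C"
  shows "(\<lambda>k. P_A (\<phi>s k)) \<longlonglongrightarrow> P_A \<phi>" (is ?P)
    and "(\<lambda>k. \<integral>x. exp_neg (\<phi>s k x) *\<^sub>R x \<partial>lborel) \<longlonglongrightarrow> (\<integral>x. exp_neg (\<phi> x) *\<^sub>R x \<partial>lborel)" (is ?M)
proof -
  have p\<phi>: "pinched a b r C \<phi>" by (rule pinched_epi_limit[OF epi p])
  have cvx: "\<phi> \<in> Cvx0" "\<phi>s k \<in> Cvx0" for k using p[of k] p\<phi> by (auto simp: pinched_def)
  note meas = Cvx0_measurable[OF cvx(1)] Cvx0_measurable[OF cvx(2)]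
  note pmeas = polarity_measurable[OF cvx(1)] polarity_measurable[OF cvx(2)]
  have fin: "integral_exp_neg \<phi> < \<infinity>"
    using pinched_Cvx0_plus[OF p\<phi> pos(1,2)] by (simp add: Cvx0_plus_def)
  have pfin: "integral_exp_neg (polarity \<phi>) < \<infinity>"
    by (rule pinched_polarity_finite[OF p\<phi> pos(2,3)])
  have growth: "ereal (a * norm x - b) \<le> \<phi>s k x" for k x using p[of k] by (simp add: pinched_def)
  have pgrowth: "ereal (r / (2 * C) * norm x - 1 / C) \<le> polarity (\<phi>s k) x" for k x
    using p[of k] pos by (intro polarity_linear_growth) (auto simp: pinched_def)
  have lim: "AE x in lborel. (\<lambda>k. exp_neg (\<phi>s k x)) \<longlonglongrightarrow> exp_neg (\<phi> x)"
    using meas(1) fin Cvx0_nonneg[OF cvx(1)] Cvx0_nonneg[OF cvx(2)] Cvx0_radial_mono[OF cvx(1)]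
      epi_lower_pointwise[OF epi] epi_radial_upper[OF epi p pos(2,3)]
    by (rule exp_neg_AE_convergence)
  have plim: "AE x in lborel. (\<lambda>k. exp_neg (polarity (\<phi>s k) x)) \<longlonglongrightarrow> exp_neg (polarity \<phi> x)"
    using pmeas(1) pfin polarity_nonneg[OF cvx(1)] polarity_nonneg[OF cvx(2)]
      polarity_radial_mono[OF cvx(1)] polarity_epi_lower[OF epi cvx(2,1)]
      polarity_epi_upper[OF epi p pos(1)]
    by (rule exp_neg_AE_convergence)
  show ?M using meas pos(1) growth lim by (rule first_moment_convergence)
  show ?P unfolding P_A_def
  proof (rule tendsto_mult_ennreal)
    show "(\<lambda>k. integral_exp_neg (\<phi>s k)) \<longlonglongrightarrow> integral_exp_neg \<phi>"
      using meas pos(1) growth lim by (rule integral_exp_neg_convergence)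
    show "(\<lambda>k. integral_exp_neg (polarity (\<phi>s k))) \<longlonglongrightarrow> integral_exp_neg (polarity \<phi>)"
      using pmeas _ pgrowth plim by (rule integral_exp_neg_convergence) (use pos in simp)
  qed (use fin pfin in auto)
qed

lemma pinched_P_A_finite:
  assumes p: "pinched a b r C \<phi>" and pos: "0 < a" "0 < r" "0 < C"
  shows "P_A \<phi> < \<infinity>"
  using pinched_Cvx0_plus[OF p pos(1,2)] pinched_polarity_finite[OF p pos(2,3)]
  by (simp add: P_A_def Cvx0_plus_def ennreal_mult_less_top)

text \<open>
  The values on \<open>S\<close> are already attained on the pinched members of \<open>S\<close>, which form a sequentially
  compact family; so the set of values is a compact subset of \<open>[0,\<infinity>]\<close> and has a largest and a
  smallest element.
\<close>
lemma achieves_extrema_by_pinching: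
  fixes S :: "('a::euclidean_space \<Rightarrow> ereal) set"
  assumes pos: "0 < a" "0 < r" "0 < C" and ne: "S \<noteq> {}"
    and pinch: "\<And>\<phi>. \<phi> \<in> S \<Longrightarrow> \<exists>\<psi>\<in>S. pinched a b r C \<psi> \<and> P_A \<psi> = P_A \<phi>"
    and closed: "\<And>\<phi>s \<phi>. epi_converges \<phi>s \<phi> \<Longrightarrow> (\<And>k. \<phi>s k \<in> S) \<Longrightarrow> (\<And>k. pinched a b r C (\<phi>s k)) \<Longrightarrow> \<phi> \<in> S"
  shows "achieves_max_on P_A S \<and> achieves_min_on P_A S"
proof -
  have "seq_compact (P_A ` S)"
    unfolding seq_compact_def
  proof (intro allI impI)
    fix v :: "nat \<Rightarrow> ennreal" assume v: "\<forall>k. v k \<in> P_A ` S"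
    have "\<exists>\<psi>. \<psi> \<in> S \<and> pinched a b r C \<psi> \<and> P_A \<psi> = v k" for k
      using v pinch by (metis imageE)
    then obtain \<psi>s :: "nat \<Rightarrow> 'a \<Rightarrow> ereal" where \<psi>s: "\<And>k. \<psi>s k \<in> S" "\<And>k. pinched a b r C (\<psi>s k)" "\<And>k. P_A (\<psi>s k) = v k"
      by metis
    obtain \<sigma> and \<phi> :: "'a \<Rightarrow> ereal" where \<sigma>: "strict_mono (\<sigma> :: nat \<Rightarrow> nat)" and epi: "epi_converges (\<lambda>k. \<psi>s (\<sigma> k)) \<phi>"
      using epi_compactness by blast
    have "\<phi> \<in> S" by (rule closed[OF epi]) (use \<psi>s in auto)
    moreover have "(\<lambda>k. P_A (\<psi>s (\<sigma> k))) \<longlonglongrightarrow> P_A \<phi>"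
      using pinched_limit(1)[OF epi _ pos] \<psi>s(2) by blast
    then have "(v \<circ> \<sigma>) \<longlonglongrightarrow> P_A \<phi>" by (simp add: \<psi>s(3) o_def)
    ultimately show "\<exists>l\<in>P_A ` S. \<exists>r. strict_mono r \<and> (v \<circ> r) \<longlonglongrightarrow> l" using \<sigma> by blast
  qed
  then have comp: "compact (P_A ` S)" using seq_compact_eq_compact by blast
  have fin: "P_A \<phi> < \<infinity>" if "\<phi> \<in> S" for \<phi>
    using pinch[OF that] pinched_P_A_finite[OF _ pos] by metis
  show ?thesis
    unfolding achieves_max_on_def achieves_min_on_def
    using compact_attains_sup[OF comp] compact_attains_inf[OF comp] ne fin by blast
qed

section \<open>Lebesgue measure under invertible matrices\<close>

text \<open>
  For boxes that touch the hyperplane \<open>x $ n = 0\<close> from above this is \<open>measure_shear_interval\<close>. A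
  translation by \<open>v\<close> brings any box into this position, and the shear turns it into a translation by
  the image of \<open>v\<close>.
\<close>
lemma measure_shear_image:
  fixes S :: "(real ^ 'n) set"
  assumes mn: "m \<noteq> n" and S: "S \<in> lmeasurable"
  shows "(\<lambda>x. \<chi> i. if i = m then x $ m + x $ n else x $ i) ` S \<in> lmeasurable \<and>
    measure lebesgue ((\<lambda>x. \<chi> i. if i = m then x $ m + x $ n else x $ i) ` S) = measure lebesgue S"
proof -
  let ?h = "\<lambda>x :: real ^ 'n. \<chi> i. if i = m then x $ m + x $ n else x $ i"
  have lin: "linear ?h" by (rule linearI) (auto simp: vec_eq_iff algebra_simps)
  have "measure lebesgue (?h ` cbox a b) = 1 * measure lebesgue (cbox a b)" for a b
  proof (cases "cbox a b = {}")
    case False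
    define v :: "real ^ 'n" where "v = (\<chi> i. if i = n then - a $ n else 0)"
    have ne: "cbox (v + a) (v + b) \<noteq> {}" using False by (simp add: cbox_translation)
    have "?h x = - ?h v + ?h (v + x)" for x
      using linear_add[OF lin, of v x] by (simp add: add.assoc[symmetric])
    then have "?h ` cbox a b = (+) (- ?h v) ` ?h ` cbox (v + a) (v + b)"
      unfolding cbox_translation image_image by (rule image_cong[OF refl])
    then have "measure lebesgue (?h ` cbox a b)
        = measure lebesgue ((+) (- ?h v) ` ?h ` cbox (v + a) (v + b))" by (rule arg_cong)
    also have "\<dots> = measure lebesgue (?h ` cbox (v + a) (v + b))" by (rule measure_translation)
    also have "\<dots> = measure lebesgue (cbox (v + a) (v + b))"
      using mn ne by (intro measure_shear_interval) (simp_all add: v_def)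
    also have "\<dots> = measure lebesgue (cbox a b)"
      unfolding cbox_translation by (rule measure_translation)
    finally show ?thesis by simp
  qed simp
  from measure_linear_sufficient[OF lin S this] show ?thesis by simp
qed

lemma measure_coordinate_swap_image:
  fixes S :: "(real ^ 'n) set"
  assumes S: "S \<in> lmeasurable"
  shows "(\<lambda>x. \<chi> i. x $ Transposition.transpose m n i) ` S \<in> lmeasurable \<and>
    measure lebesgue ((\<lambda>x. \<chi> i. x $ Transposition.transpose m n i) ` S) = measure lebesgue S"
proof -
  let ?t = "Transposition.transpose m n"
  let ?h = "\<lambda>x :: real ^ 'n. \<chi> i. x $ ?t i"
  have lin: "linear ?h" by (rule linearI) (auto simp: vec_eq_iff)
  have "measure lebesgue (?h ` cbox a b) = 1 * measure lebesgue (cbox a b)" for a b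
  proof (cases "cbox a b = {}")
    case False
    have hh: "?h (?h x) = x" for x by (simp add: vec_eq_iff)
    have mem: "?h x \<in> cbox (?h u) (?h w)" if "x \<in> cbox u w" for x u w
      using that by (simp add: mem_box_cart)
    have "cbox (?h a) (?h b) \<subseteq> ?h ` cbox a b"
    proof
      fix y assume "y \<in> cbox (?h a) (?h b)"
      then have "?h y \<in> cbox a b" using mem[of y "?h a" "?h b"] unfolding hh by simp
      then have "?h (?h y) \<in> ?h ` cbox a b" by (rule imageI)
      then show "y \<in> ?h ` cbox a b" unfolding hh .
    qed
    moreover have "?h ` cbox a b \<subseteq> cbox (?h a) (?h b)" using mem by (rule image_subsetI)
    ultimately have eq: "?h ` cbox a b = cbox (?h a) (?h b)" by (rule antisym[rotated])
    have "(\<Prod>i\<in>UNIV. ?h b $ i - ?h a $ i) = (\<Prod>i\<in>UNIV. (\<lambda>i. b $ i - a $ i) (?t i))" by simp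
    also have "\<dots> = (\<Prod>i\<in>UNIV. b $ i - a $ i)"
      by (rule prod.reindex_bij_betw) simp
    finally show ?thesis
      using False eq content_cbox_cart[of a b] content_cbox_cart[of "?h a" "?h b"] by auto
  qed simp
  from measure_linear_sufficient[OF lin S this] show ?thesis by simp
qed

text \<open>
  Induction over products of elementary matrices. The index type carries no order, so a shear is not
  triangular in any sense; its determinant comes from a row operation instead.
\<close>
lemma measure_matrix_image:
  fixes A :: "real ^ 'n ^ 'n"
  assumes "S \<in> lmeasurable"
  shows "(*v) A ` S \<in> lmeasurable \<and> measure lebesgue ((*v) A ` S) = \<bar>det A\<bar> * measure lebesgue S"
proof -
  have "\<forall>S\<in>lmeasurable. (*v) A ` S \<in> lmeasurable \<and>
      measure lebesgue ((*v) A ` S) = \<bar>det A\<bar> * measure lebesgue S"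
  proof (rule induct_matrix_elementary_alt[of _ A]; intro ballI)
    fix A B :: "real ^ 'n ^ 'n" and S :: "(real ^ 'n) set"
    assume A: "\<forall>S\<in>lmeasurable. (*v) A ` S \<in> lmeasurable \<and> measure lebesgue ((*v) A ` S) = \<bar>det A\<bar> * measure lebesgue S"
      and B: "\<forall>S\<in>lmeasurable. (*v) B ` S \<in> lmeasurable \<and> measure lebesgue ((*v) B ` S) = \<bar>det B\<bar> * measure lebesgue S"
      and S: "S \<in> lmeasurable"
    have "(*v) (A ** B) ` S = (*v) A ` (*v) B ` S"
      by (simp add: image_image matrix_vector_mul_assoc)
    then show "(*v) (A ** B) ` S \<in> lmeasurable \<and> measure lebesgue ((*v) (A ** B) ` S) = \<bar>det (A ** B)\<bar> * measure lebesgue S"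
      using A B S by (simp add: det_mul abs_mult)
  next
    fix A :: "real ^ 'n ^ 'n" and i and S :: "(real ^ 'n) set"
    assume r: "row i A = 0"
    have "(A *v x) $ i = 0" for x using r by (simp add: matrix_vector_mul_component row_def vec_lambda_eta)
    then have "(*v) A ` S \<subseteq> {x. x $ i = 0}" by auto
    then have "negligible ((*v) A ` S)" by (rule negligible_subset[OF negligible_standard_hyperplane_cart])
    then show "(*v) A ` S \<in> lmeasurable \<and> measure lebesgue ((*v) A ` S) = \<bar>det A\<bar> * measure lebesgue S"
      using det_zero_row(2)[OF r] by (simp add: negligible_imp_measurable negligible_imp_measure0)
  next
    fix A :: "real ^ 'n ^ 'n" and S :: "(real ^ 'n) set"
    assume diag: "\<And>i j. i \<noteq> j \<Longrightarrow> A $ i $ j = 0" and S: "S \<in> lmeasurable"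
    have "(A *v x) $ i = A $ i $ i * x $ i" for x i
    proof -
      have "(A *v x) $ i = (\<Sum>j\<in>UNIV. if j = i then A $ i $ i * x $ i else 0)"
        unfolding matrix_vector_mult_def vec_lambda_beta
      proof (rule sum.cong[OF refl])
        fix j show "A $ i $ j * x $ j = (if j = i then A $ i $ i * x $ i else 0)"
          using diag[of i j] by auto
      qed
      then show ?thesis by simp
    qed
    then have "(*v) A = (\<lambda>x. \<chi> i. A $ i $ i * x $ i)" by (auto simp: vec_eq_iff)
    then show "(*v) A ` S \<in> lmeasurable \<and> measure lebesgue ((*v) A ` S) = \<bar>det A\<bar> * measure lebesgue S"
      using measurable_stretch[OF S] measure_stretch[OF S] det_diagonal[OF diag] by simp
  next
    fix m n :: 'n and S :: "(real ^ 'n) set"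
    assume "m \<noteq> n" and S: "S \<in> lmeasurable"
    let ?t = "Transposition.transpose m n"
    let ?A = "(\<chi> i j. mat 1 $ i $ ?t j) :: real ^ 'n ^ 'n"
    have "(?A *v x) $ i = x $ ?t i" for x i
    proof -
      have "(?A *v x) $ i = (\<Sum>j\<in>UNIV. if j = ?t i then x $ j else 0)"
        unfolding matrix_vector_mult_def vec_lambda_beta
      proof (rule sum.cong[OF refl])
        fix j
        have "i = ?t j \<longleftrightarrow> j = ?t i" by (metis transpose_involutory)
        then show "mat 1 $ i $ ?t j * x $ j = (if j = ?t i then x $ j else 0)"
          by (simp add: mat_def)
      qed
      then show ?thesis by simp
    qed
    then have "(*v) ?A = (\<lambda>x. \<chi> i. x $ ?t i)" by (auto simp: vec_eq_iff)
    moreover have "\<bar>det ?A\<bar> = 1"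
      by (simp add: det_permute_columns permutes_swap_id sign_swap_id abs_mult)
    ultimately show "(*v) ?A ` S \<in> lmeasurable \<and> measure lebesgue ((*v) ?A ` S) = \<bar>det ?A\<bar> * measure lebesgue S"
      using measure_coordinate_swap_image[OF S, of m n] by simp
  next
    fix m n :: 'n and S :: "(real ^ 'n) set"
    assume mn: "m \<noteq> n" and S: "S \<in> lmeasurable"
    let ?A = "(\<chi> i j. of_bool (i = m \<and> j = n \<or> i = j)) :: real ^ 'n ^ 'n"
    have "(?A *v x) $ i = (if i = m then x $ m + x $ n else x $ i)" for x i
    proof -
      have "(?A *v x) $ i = (\<Sum>j\<in>UNIV. (if j = i then x $ i else 0) + (if j = n then (if i = m then x $ n else 0) else 0))"
        unfolding matrix_vector_mult_def using mn by (auto intro!: sum.cong)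
      then show ?thesis by (simp add: sum.distrib)
    qed
    then have "(*v) ?A = (\<lambda>x. \<chi> i. if i = m then x $ m + x $ n else x $ i)" by (auto simp: vec_eq_iff)
    moreover have "det ?A = 1"
    proof -
      have "?A = (\<chi> k. if k = m then row m (mat 1) + 1 *s row n (mat 1) else row k (mat 1))"
        using mn by (auto simp: vec_eq_iff row_def mat_def)
      then show ?thesis using det_row_operation[OF mn, of "mat 1 :: real ^ 'n ^ 'n" 1] by simp
    qed
    ultimately show "(*v) ?A ` S \<in> lmeasurable \<and> measure lebesgue ((*v) ?A ` S) = \<bar>det ?A\<bar> * measure lebesgue S"
      using measure_shear_image[OF mn S] by simp
  qed
  then show ?thesis using assms by blast
qed

text \<open>
  The preimage of a box is bounded and open, and its image under \<open>A\<close> is the box again, so that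
  \<open>measure_matrix_image\<close> applies to it.
\<close>
lemma lborel_matrix:
  fixes A :: "real ^ 'n ^ 'n"
  assumes det: "det A \<noteq> 0"
  shows "lborel = density (distr lborel borel ((*v) A)) (\<lambda>_. ennreal \<bar>det A\<bar>)"
proof (rule lborel_eqI)
  have cont: "continuous_on UNIV ((*v) A)" by (intro linear_continuous_on) simp
  then have [measurable]: "(*v) A \<in> borel_measurable borel" by (rule borel_measurable_continuous_onI)
  obtain B where B: "A ** B = mat 1" "B ** A = mat 1"
    using det invertible_det_nz[of A] unfolding invertible_def by blast
  have AB: "A *v (B *v x) = x" "B *v (A *v x) = x" for x
    using B by (simp_all add: matrix_vector_mul_assoc)
  fix l u :: "real ^ 'n" assume lu: "\<And>b. b \<in> Basis \<Longrightarrow> l \<bullet> b \<le> u \<bullet> b"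
  let ?S = "(*v) A -` box l u"
  have "?S = (*v) B ` box l u" using AB by (auto simp: image_iff intro: bexI[of _ "A *v _"]) (metis AB)
  then have "bounded ?S" by (simp add: bounded_linear_image bounded_box)
  moreover have S: "open ?S" by (rule open_vimage[OF open_box cont])
  ultimately have lS: "?S \<in> lmeasurable" by (rule lmeasurable_open)
  have "(*v) A ` ?S = box l u" using AB by (auto simp: image_iff) (metis AB(1))
  then have m: "measure lebesgue (box l u) = \<bar>det A\<bar> * measure lebesgue ?S"
    using measure_matrix_image[OF lS, of A] by simp
  have "emeasure lborel ?S = emeasure lebesgue ?S" using S by simp
  also have "\<dots> = ennreal (measure lebesgue ?S)" using lS by (simp add: emeasure_eq_measure2)
  finally have eS: "emeasure lborel ?S = ennreal (measure lebesgue ?S)" .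
  have "emeasure (density (distr lborel borel ((*v) A)) (\<lambda>_. ennreal \<bar>det A\<bar>)) (box l u)
      = ennreal \<bar>det A\<bar> * emeasure lborel ?S"
    by (simp add: emeasure_density nn_integral_cmult_indicator emeasure_distr)
  also have "\<dots> = ennreal (measure lebesgue (box l u))"
    by (simp add: eS m ennreal_mult)
  also have "\<dots> = (\<Prod>b\<in>Basis. (u - l) \<bullet> b)"
    using lu by (simp add: measure_completion measure_lborel_box inner_diff_left)
  finally show "emeasure (density (distr lborel borel ((*v) A)) (\<lambda>_. ennreal \<bar>det A\<bar>)) (box l u)
      = (\<Prod>b\<in>Basis. (u - l) \<bullet> b)" .
qed simp

lemma matrix_vector_measurable [measurable]:
  fixes A :: "real ^ 'n ^ 'm"
  shows "(*v) A \<in> borel_measurable borel"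
  by (intro borel_measurable_continuous_onI linear_continuous_on) simp

lemma nn_integral_matrix:
  fixes A :: "real ^ 'n ^ 'n" and F :: "real ^ 'n \<Rightarrow> ennreal"
  assumes det: "det A \<noteq> 0" and [measurable]: "F \<in> borel_measurable borel"
  shows "(\<integral>\<^sup>+ x. F x \<partial>lborel) = ennreal \<bar>det A\<bar> * (\<integral>\<^sup>+ x. F (A *v x) \<partial>lborel)"
proof -
  have "(\<integral>\<^sup>+ x. F x \<partial>lborel) = (\<integral>\<^sup>+ x. F x \<partial>density (distr lborel borel ((*v) A)) (\<lambda>_. ennreal \<bar>det A\<bar>))"
    using lborel_matrix[OF det] by simp
  also have "\<dots> = ennreal \<bar>det A\<bar> * (\<integral>\<^sup>+ x. F (A *v x) \<partial>lborel)"
    by (simp add: nn_integral_density nn_integral_distr nn_integral_cmult)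
  finally show ?thesis .
qed

lemma integral_matrix:
  fixes A :: "real ^ 'n ^ 'n" and f :: "real ^ 'n \<Rightarrow> 'b::{banach, second_countable_topology}"
  assumes det: "det A \<noteq> 0" and [measurable]: "f \<in> borel_measurable borel"
  shows "(\<integral>x. f x \<partial>lborel) = \<bar>det A\<bar> *\<^sub>R (\<integral>x. f (A *v x) \<partial>lborel)"
proof -
  have "(\<integral>x. f x \<partial>lborel) = (\<integral>x. f x \<partial>density (distr lborel borel ((*v) A)) (\<lambda>_. ennreal \<bar>det A\<bar>))"
    using lborel_matrix[OF det] by simp
  also have "\<dots> = \<bar>det A\<bar> *\<^sub>R (\<integral>x. f (A *v x) \<partial>lborel)"
    by (simp add: integral_density integral_distr)
  finally show ?thesis .
qed

section \<open>Linear invariance\<close>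

lemma integral_exp_neg_matrix:
  fixes A :: "real ^ 'n ^ 'n"
  assumes "det A \<noteq> 0" "\<psi> \<in> borel_measurable borel"
  shows "integral_exp_neg \<psi> = ennreal \<bar>det A\<bar> * integral_exp_neg (\<lambda>x. \<psi> (A *v x))"
  unfolding integral_exp_neg_def using exp_neg_measurable_comp[OF assms(2)]
  by (intro nn_integral_matrix assms(1) measurable_compose[OF _ measurable_ennreal])

lemma Cvx0_matrix:
  fixes A :: "real ^ 'n ^ 'n"
  assumes \<phi>: "\<phi> \<in> Cvx0"
  shows "(\<lambda>x. \<phi> (A *v x)) \<in> Cvx0"
proof -
  have cont: "continuous_on UNIV ((*v) A)" by (intro linear_continuous_on) simp
  have "open ((*v) A -` {x. c < \<phi> x})" for c
    by (intro open_vimage Cvx0_open[OF \<phi>] cont)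
  then have "lower_semicontinuous (\<lambda>x. \<phi> (A *v x))"
    unfolding lower_semicontinuous_iff_open by (simp add: vimage_def)
  moreover have "convex_ereal (\<lambda>x. \<phi> (A *v x))"
    using \<phi> unfolding Cvx0_def convex_ereal_def
    by (simp add: matrix_vector_right_distrib matrix_vector_mult_scaleR)
  ultimately show ?thesis using \<phi> by (simp add: Cvx0_def)
qed

text \<open>
  Substitute \<open>x \<mapsto> A x\<close> in the affine conditions of \<open>polarity_le_iff\<close>.
\<close>
lemma polarity_matrix:
  fixes A B :: "real ^ 'n ^ 'n"
  assumes \<phi>: "\<phi> \<in> Cvx0" and AB: "A ** B = mat 1" "B ** A = mat 1"
  shows "polarity (\<lambda>x. \<phi> (A *v x)) y = polarity \<phi> (transpose B *v y)"
proof (rule nonneg_ereal_eqI)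
  show "0 \<le> polarity (\<lambda>x. \<phi> (A *v x)) y" "0 \<le> polarity \<phi> (transpose B *v y)"
    by (intro polarity_nonneg \<phi> Cvx0_matrix)+
  fix c :: real assume c: "0 \<le> c"
  have dot: "x \<bullet> (transpose B *v y) = (B *v x) \<bullet> y" for x
    by (metis transpose_matrix_vector dot_lmul_matrix inner_commute)
  have inv: "A *v (B *v x) = x" "B *v (A *v x) = x" for x
    using AB by (simp_all add: matrix_vector_mul_assoc)
  show "polarity (\<lambda>x. \<phi> (A *v x)) y \<le> ereal c \<longleftrightarrow> polarity \<phi> (transpose B *v y) \<le> ereal c"
    unfolding polarity_le_iff[OF \<phi> c] polarity_le_iff[OF Cvx0_matrix[OF \<phi>] c] dot
    using inv by metis
qed

text \<open>
  The first integral is divided and the second one multiplied by \<open>\<bar>det A\<bar>\<close>.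
\<close>
lemma P_A_matrix:
  fixes A :: "real ^ 'n ^ 'n"
  assumes \<phi>: "\<phi> \<in> Cvx0" and det: "det A \<noteq> 0"
  shows "P_A (\<lambda>x. \<phi> (A *v x)) = P_A \<phi>"
proof -
  obtain B where B: "A ** B = mat 1" "B ** A = mat 1"
    using det invertible_det_nz[of A] unfolding invertible_def by blast
  have "det A * det B = 1" using B(1) det_mul[of A B] by simp
  then have detB: "\<bar>det A\<bar> * \<bar>det B\<bar> = 1" "det (transpose B) \<noteq> 0"
    by (auto simp flip: abs_mult)
  have I1: "integral_exp_neg \<phi> = ennreal \<bar>det A\<bar> * integral_exp_neg (\<lambda>x. \<phi> (A *v x))"
    by (rule integral_exp_neg_matrix[OF det Cvx0_measurable[OF \<phi>]])
  have I2: "integral_exp_neg (polarity \<phi>) = ennreal \<bar>det B\<bar> * integral_exp_neg (polarity (\<lambda>x. \<phi> (A *v x)))"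
    unfolding polarity_matrix[OF \<phi> B]
    using integral_exp_neg_matrix[OF detB(2) polarity_measurable[OF \<phi>]] by simp
  have "P_A \<phi> = (ennreal \<bar>det A\<bar> * ennreal \<bar>det B\<bar>) * P_A (\<lambda>x. \<phi> (A *v x))"
    unfolding P_A_def I1 I2 by (simp only: mult_ac)
  also have "ennreal \<bar>det A\<bar> * ennreal \<bar>det B\<bar> = 1"
    using detB by (simp flip: ennreal_mult)
  finally show ?thesis by simp
qed

lemma Cvx0_plus_matrix:
  fixes A :: "real ^ 'n ^ 'n"
  assumes \<phi>: "\<phi> \<in> Cvx0_plus" and det: "det A \<noteq> 0"
  shows "(\<lambda>x. \<phi> (A *v x)) \<in> Cvx0_plus"
proof -
  have c: "\<phi> \<in> Cvx0" using \<phi> by (simp add: Cvx0_plus_def)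
  have "integral_exp_neg \<phi> = ennreal \<bar>det A\<bar> * integral_exp_neg (\<lambda>x. \<phi> (A *v x))"
    by (rule integral_exp_neg_matrix[OF det Cvx0_measurable[OF c]])
  then show ?thesis
    using \<phi> det Cvx0_matrix[OF c, of A]
    by (auto simp: Cvx0_plus_def ennreal_zero_less_mult_iff ennreal_mult_less_top)
qed

lemma centroid_matrix:
  fixes A :: "real ^ 'n ^ 'n"
  assumes \<phi>: "\<phi> \<in> Cvx0_plus" and det: "det A \<noteq> 0" and c: "centroid \<phi> = 0"
  shows "centroid (\<lambda>x. \<phi> (A *v x)) = 0"
proof -
  obtain B where B: "A ** B = mat 1" "B ** A = mat 1"
    using det invertible_det_nz[of A] unfolding invertible_def by blast
  have [measurable]: "(\<lambda>x. exp_neg (\<phi> x)) \<in> borel_measurable borel"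
    using \<phi> by (simp add: Cvx0_plus_def exp_neg_measurable_comp Cvx0_measurable)
  have "0 = B *v (\<integral>x. exp_neg (\<phi> x) *\<^sub>R x \<partial>lborel)"
    using c centroid_eq_0_iff[OF \<phi>] by simp
  also have "\<dots> = B *v (\<bar>det A\<bar> *\<^sub>R (\<integral>x. exp_neg (\<phi> (A *v x)) *\<^sub>R (A *v x) \<partial>lborel))"
    by (subst integral_matrix[OF det]) auto
  also have "\<dots> = \<bar>det A\<bar> *\<^sub>R (B *v (A *v (\<integral>x. exp_neg (\<phi> (A *v x)) *\<^sub>R x \<partial>lborel)))"
  proof -
    have "A *v (\<integral>x. exp_neg (\<phi> (A *v x)) *\<^sub>R x \<partial>lborel) = (\<integral>x. A *v (exp_neg (\<phi> (A *v x)) *\<^sub>R x) \<partial>lborel)"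
      by (rule integral_bounded_linear'[symmetric, where T' = "(*v) B"])
         (simp_all add: matrix_vector_mul_assoc B matrix_vector_mul_bounded_linear)
    then show ?thesis by (simp add: matrix_vector_mult_scaleR)
  qed
  also have "\<dots> = \<bar>det A\<bar> *\<^sub>R (\<integral>x. exp_neg (\<phi> (A *v x)) *\<^sub>R x \<partial>lborel)"
    by (simp add: matrix_vector_mul_assoc B)
  finally show ?thesis using det centroid_eq_0_iff[OF Cvx0_plus_matrix[OF \<phi> det]] by simp
qed

lemma even_matrix:
  fixes A :: "real ^ 'n ^ 'n"
  shows "even_fun \<phi> \<Longrightarrow> even_fun (\<lambda>x. \<phi> (A *v x))"
  using matrix_vector_mult_scaleR[of A "- 1"] by (simp add: even_fun_def)

section \<open>Normal position\<close>

text \<open>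
  The box lies in the simplex spanned by \<open>0\<close> and the unit vectors: a point \<open>x\<close> of it is the average of
  the \<open>n\<close> points \<open>n * x $ i * e\<^sub>i\<close>, each of which lies on the segment from \<open>0\<close> to \<open>e\<^sub>i\<close>.
\<close>
lemma Cvx0_sublevel_contains_box:
  fixes \<psi> :: "real ^ 'n \<Rightarrow> ereal"
  assumes \<psi>: "\<psi> \<in> Cvx0" and ax: "\<And>i. \<psi> (axis i 1) \<le> 1"
    and x: "\<And>i. 0 \<le> x $ i" "\<And>i. x $ i \<le> 1 / CARD('n)"
  shows "\<psi> x \<le> 1"
proof -
  let ?n = "real CARD('n)"
  have n: "0 < ?n" by simp
  have "convex {z. \<psi> z \<le> 1}" using convex_Cvx0_sublevel[OF \<psi>, of 1] by (simp add: one_ereal_def)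
  then have "(\<Sum>i\<in>(UNIV::'n set). (1 / ?n) *\<^sub>R ((?n * x $ i) *\<^sub>R axis i 1)) \<in> {z. \<psi> z \<le> 1}"
  proof (rule convex_sum[rotated])
    fix i :: 'n
    have le: "?n * x $ i \<le> 1" using x(2)[of i] n by (simp add: field_simps)
    have "\<psi> ((?n * x $ i) *\<^sub>R axis i 1) \<le> ereal (?n * x $ i * 1)"
      using x(1)[of i] le ax[of i] by (intro Cvx0_scale_le[OF \<psi>]) (auto simp: one_ereal_def)
    also have "\<dots> \<le> 1" using le by (simp add: one_ereal_def)
    finally show "(?n * x $ i) *\<^sub>R axis i 1 \<in> {z. \<psi> z \<le> 1}" by simp
  qed auto
  also have "(\<Sum>i\<in>(UNIV::'n set). (1 / ?n) *\<^sub>R ((?n * x $ i) *\<^sub>R axis i 1)) = x"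
    by (simp add: vec_eq_iff axis_def if_distrib cong: if_cong)
  finally show ?thesis by simp
qed

lemma content_cube:
  fixes l :: real
  assumes "0 \<le> l"
  shows "measure lborel (cbox 0 (\<chi> i. l) :: (real ^ 'n) set) = l ^ CARD('n)"
    and "emeasure lborel (cbox 0 (\<chi> i. l) :: (real ^ 'n) set) = ennreal (l ^ CARD('n))"
proof -
  have ne: "cbox 0 (\<chi> i. l) \<noteq> ({} :: (real ^ 'n) set)"
    using assms by (auto simp: interval_ne_empty_cart)
  show m: "measure lborel (cbox 0 (\<chi> i. l) :: (real ^ 'n) set) = l ^ CARD('n)"
    using content_cbox_cart[OF ne] by simp
  show "emeasure lborel (cbox 0 (\<chi> i. l) :: (real ^ 'n) set) = ennreal (l ^ CARD('n))"
    unfolding m[symmetric] using emeasure_lborel_cbox_finite by (intro emeasure_eq_ennreal_measure) (simp add: less_top)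
qed

lemma integral_exp_neg_lower_bound:
  fixes \<psi> :: "real ^ 'n \<Rightarrow> ereal"
  assumes \<psi>: "\<psi> \<in> Cvx0" and ax: "\<And>i. \<psi> (axis i 1) \<le> 1"
  shows "ennreal (exp (- 1) * (1 / CARD('n)) ^ CARD('n)) \<le> integral_exp_neg \<psi>"
proof -
  let ?Q = "cbox 0 (\<chi> i. 1 / CARD('n)) :: (real ^ 'n) set"
  have "ennreal (exp (- 1) * (1 / CARD('n)) ^ CARD('n)) = ennreal (exp (- 1)) * emeasure lborel ?Q"
    by (simp add: content_cube ennreal_mult)
  also have "\<dots> = (\<integral>\<^sup>+ x. ennreal (exp (- 1)) * indicator ?Q x \<partial>lborel)"
    by (subst nn_integral_cmult_indicator) auto
  also have "\<dots> \<le> integral_exp_neg \<psi>"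
    unfolding integral_exp_neg_def
  proof (intro nn_integral_mono)
    fix x :: "real ^ 'n"
    show "ennreal (exp (- 1)) * indicator ?Q x \<le> ennreal (exp_neg (\<psi> x))"
    proof (cases "x \<in> ?Q")
      case True
      then have "\<psi> x \<le> 1" by (intro Cvx0_sublevel_contains_box[OF \<psi> ax]) (simp_all add: mem_box_cart)
      then have "exp_neg 1 \<le> exp_neg (\<psi> x)" by (intro exp_neg_antimono Cvx0_nonneg[OF \<psi>])
      then show ?thesis using True by (simp add: one_ereal_def ennreal_leI)
    qed simp
  qed
  finally show ?thesis .
qed

text \<open>
  Every point where \<open>\<phi>\<close> is finite is a multiple of a point of the sublevel set. If these points lay in
  a proper subspace, \<open>exp (- \<phi>)\<close> would vanish almost everywhere.
\<close>
lemma span_sublevel: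
  fixes \<phi> :: "'a::euclidean_space \<Rightarrow> ereal"
  assumes \<phi>: "\<phi> \<in> Cvx0_plus"
  shows "span {x. \<phi> x \<le> 1} = UNIV"
proof (rule ccontr)
  let ?K = "{x. \<phi> x \<le> 1}"
  have cvx: "\<phi> \<in> Cvx0" using \<phi> by (simp add: Cvx0_plus_def)
  assume "span ?K \<noteq> UNIV"
  then have "dim (span ?K) < DIM('a)"
    using dim_eq_full[of ?K] dim_subset_UNIV[of ?K] by (simp add: less_le)
  then have "negligible (span ?K)" by (rule negligible_lowdim)
  then have null: "span ?K \<in> null_sets lebesgue" by (simp add: negligible_iff_null_sets)
  have inf: "exp_neg (\<phi> x) = 0" if x: "x \<notin> span ?K" for x
  proof (cases "\<phi> x")
    case (real p)
    have p: "0 \<le> p" using Cvx0_nonneg[OF cvx, of x] real by simp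
    define t where "t = 1 / (1 + p)"
    have t: "0 < t" "t \<le> 1" "t * p \<le> 1" using p by (auto simp: t_def field_simps)
    have "\<phi> (t *\<^sub>R x) \<le> ereal (t * p)" using t real by (intro Cvx0_scale_le[OF cvx]) auto
    also have "\<dots> \<le> 1" using t by (simp add: one_ereal_def)
    finally have "t *\<^sub>R x \<in> span ?K" by (intro span_base) simp
    then have "(1 / t) *\<^sub>R (t *\<^sub>R x) \<in> span ?K" by (rule span_mul)
    then show ?thesis using x t by simp
  qed (use Cvx0_nonneg[OF cvx, of x] in auto)
  have "AE x in lebesgue. x \<notin> span ?K" using null by (rule AE_not_in)
  then have "AE x in lebesgue. ennreal (exp_neg (\<phi> x)) = 0" by eventually_elim (simp add: inf)
  moreover have [measurable]: "(\<lambda>x. ennreal (exp_neg (\<phi> x))) \<in> borel_measurable lborel"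
    using exp_neg_measurable_comp[OF Cvx0_measurable[OF cvx]] by measurable
  ultimately have "AE x in lborel. ennreal (exp_neg (\<phi> x)) = 0"
    by (subst (asm) AE_completion_iff) auto
  then have "integral_exp_neg \<phi> = 0"
    unfolding integral_exp_neg_def by (subst nn_integral_0_iff_AE) (simp_all add: exp_neg_measurable_comp[OF Cvx0_measurable[OF cvx]])
  then show False using \<phi> by (simp add: Cvx0_plus_def)
qed

lemma ex_matrix_columns_in_spanning_set:
  fixes K :: "(real ^ 'n) set"
  assumes "span K = UNIV"
  obtains A :: "real ^ 'n ^ 'n" where "\<And>i. column i A \<in> K" "det A \<noteq> 0"
proof -
  obtain B where B: "B \<subseteq> K" "independent B" "K \<subseteq> span B" "card B = dim K"
    using basis_exists by blast
  have spB: "span B = UNIV" using assms span_mono[OF B(3)] by (simp add: span_span top.extremum_unique)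
  have "card B = CARD('n)" using B(4) assms dim_eq_full[of K] by simp
  moreover have "finite B" using B(2) by (rule independent_imp_finite)
  ultimately obtain f where f: "bij_betw f (UNIV :: 'n set) B"
    by (metis finite_class.finite_UNIV finite_same_card_bij)
  define A :: "real ^ 'n ^ 'n" where "A = (\<chi> i j. f j $ i)"
  have col: "column j A = f j" for j by (simp add: A_def column_def vec_eq_iff)
  have "columns A = B" using f by (auto simp: columns_def col bij_betw_def)
  then have "\<exists>B'. A ** B' = mat 1" unfolding matrix_right_invertible_span_columns using spB by (simp add: span_vec_eq)
  then have "det A \<noteq> 0" using invertible_right_inverse invertible_det_nz by blast
  moreover have "column i A \<in> K" for i using col f B(1) by (auto simp: bij_betw_def)
  ultimately show thesis using that by blast
qed

text \<open>
  The determinants of matrices with columns in \<open>K = {\<phi> \<le> 1}\<close> are bounded, since \<open>K\<close> contains the image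
  of a fixed box under such a matrix and the measure of \<open>K\<close> is controlled by the integral of
  \<open>exp (- \<phi>)\<close>; they are not all \<open>0\<close>, since \<open>K\<close> spans. For a matrix \<open>A\<close> with more than half of the largest
  possible determinant, replacing its \<open>k\<close>-th column by a point \<open>A y\<close> of \<open>K\<close> multiplies the determinant by
  \<open>y $ k\<close>, which is therefore at most \<open>2\<close> in absolute value. Settling for half of the supremum avoids
  showing that \<open>K\<close> is compact.
\<close>
lemma ex_normalising_matrix:
  fixes \<phi> :: "real ^ 'n \<Rightarrow> ereal"
  assumes \<phi>: "\<phi> \<in> Cvx0_plus"
  obtains A :: "real ^ 'n ^ 'n" where "det A \<noteq> 0" "\<And>i. \<phi> (A *v axis i 1) \<le> 1"
    "\<And>y i. \<phi> (A *v y) \<le> 1 \<Longrightarrow> \<bar>y $ i\<bar> \<le> 2"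
proof -
  have cvx: "\<phi> \<in> Cvx0" and fin: "integral_exp_neg \<phi> < \<infinity>" using \<phi> by (auto simp: Cvx0_plus_def)
  define G where "G = {A :: real ^ 'n ^ 'n. \<forall>i. \<phi> (column i A) \<le> 1}"
  define D where "D = (\<lambda>A. \<bar>det A\<bar>) ` G"
  define \<epsilon> where "\<epsilon> = exp (- 1) * (1 / CARD('n)) ^ CARD('n)"
  have \<epsilon>: "0 < \<epsilon>" by (simp add: \<epsilon>_def)
  have "\<bar>det A\<bar> \<le> enn2real (integral_exp_neg \<phi>) / \<epsilon>" if A: "A \<in> G" for A
  proof (cases "det A = 0")
    case False
    have "ennreal \<epsilon> \<le> integral_exp_neg (\<lambda>x. \<phi> (A *v x))"
      unfolding \<epsilon>_def using A
      by (intro integral_exp_neg_lower_bound Cvx0_matrix cvx) (simp add: G_def matrix_vector_mult_basis)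
    then have "ennreal (\<bar>det A\<bar> * \<epsilon>) \<le> ennreal \<bar>det A\<bar> * integral_exp_neg (\<lambda>x. \<phi> (A *v x))"
      using \<epsilon> by (simp add: ennreal_mult mult_left_mono)
    also have "\<dots> = integral_exp_neg \<phi>"
      by (rule integral_exp_neg_matrix[OF False Cvx0_measurable[OF cvx], symmetric])
    also have "\<dots> = ennreal (enn2real (integral_exp_neg \<phi>))" using fin by simp
    finally have "\<bar>det A\<bar> * \<epsilon> \<le> enn2real (integral_exp_neg \<phi>)"
      by (subst (asm) ennreal_le_iff) auto
    then show ?thesis using \<epsilon> by (simp add: field_simps)
  qed (use \<epsilon> in simp)
  then have bdd: "bdd_above D" unfolding D_def by (auto intro!: bdd_aboveI)
  obtain A0 :: "real ^ 'n ^ 'n" where A0: "\<And>i. column i A0 \<in> {x. \<phi> x \<le> 1}" "det A0 \<noteq> 0"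
    using ex_matrix_columns_in_spanning_set[OF span_sublevel[OF \<phi>]] by blast
  then have A0D: "\<bar>det A0\<bar> \<in> D" by (auto simp: D_def G_def)
  then have "\<bar>det A0\<bar> \<le> Sup D" using bdd by (rule cSup_upper)
  then have sup: "0 < Sup D" using A0(2) by simp
  then have "\<exists>d\<in>D. Sup D / 2 < d" using A0D by (intro less_cSupD) auto
  then obtain A where A: "A \<in> G" "Sup D / 2 < \<bar>det A\<bar>" by (auto simp: D_def)
  have det: "det A \<noteq> 0" using A sup by auto
  show thesis
  proof (rule that[OF det])
    show "\<phi> (A *v axis i 1) \<le> 1" for i using A(1) by (simp add: G_def matrix_vector_mult_basis)
    fix y k assume y: "\<phi> (A *v y) \<le> 1"
    let ?B = "(\<chi> i j. if j = k then (A *v y) $ i else A $ i $ j) :: real ^ 'n ^ 'n"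
    have "column i ?B = (if i = k then A *v y else column i A)" for i
      by (simp add: column_def vec_eq_iff)
    then have "?B \<in> G" using A(1) y by (simp add: G_def)
    then have "\<bar>det ?B\<bar> \<le> Sup D" using bdd by (intro cSup_upper) (auto simp: D_def)
    also have "det ?B = y $ k * det A" by (rule cramer_lemma)
    finally have "\<bar>y $ k\<bar> * \<bar>det A\<bar> \<le> 2 * \<bar>det A\<bar>" using A(2) by (simp add: abs_mult)
    then show "\<bar>y $ k\<bar> \<le> 2" using det by simp
  qed
qed

text \<open>
  If \<open>\<psi> y = p\<close>, then \<open>y / (p + 1)\<close> lies in the sublevel set, which is bounded.
\<close>
lemma growth_of_bounded_sublevel:
  fixes \<psi> :: "real ^ 'n \<Rightarrow> ereal"
  assumes \<psi>: "\<psi> \<in> Cvx0" and bd: "\<And>y i. \<psi> y \<le> 1 \<Longrightarrow> \<bar>y $ i\<bar> \<le> 2"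
  shows "ereal (1 / (3 * CARD('n)) * norm y - 1) \<le> \<psi> y"
proof (cases "\<psi> y")
  case (real p)
  have p: "0 \<le> p" using Cvx0_nonneg[OF \<psi>, of y] real by simp
  have comp: "\<bar>y $ i\<bar> \<le> 3 * (p + 1)" for i
  proof -
    define t where "t = 1 / (p + 1)"
    have t: "0 < t" "t \<le> 1" "t * p \<le> 1" using p by (auto simp: t_def field_simps)
    have "\<psi> (t *\<^sub>R y) \<le> ereal (t * p)" using t real by (intro Cvx0_scale_le[OF \<psi>]) auto
    also have "\<dots> \<le> 1" using t by (simp add: one_ereal_def)
    finally have "\<bar>(t *\<^sub>R y) $ i\<bar> \<le> 2" by (rule bd)
    then have "\<bar>y $ i\<bar> \<le> 2 * (p + 1)" using p by (simp add: t_def abs_mult field_simps)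
    then show ?thesis using p by linarith
  qed
  have "norm y \<le> (\<Sum>i\<in>UNIV. \<bar>y $ i\<bar>)" by (rule norm_le_l1_cart)
  also have "\<dots> \<le> (\<Sum>i\<in>(UNIV::'n set). 3 * (p + 1))" by (intro sum_mono comp)
  finally have "norm y \<le> 3 * CARD('n) * (p + 1)" by (simp only: sum_constant mult_ac of_nat_mult of_nat_numeral)
  then have "norm y / (3 * CARD('n)) \<le> p + 1" by (simp add: divide_le_eq mult.commute)
  then show ?thesis using real by simp
qed (use Cvx0_nonneg[OF \<psi>, of y] in auto)

text \<open>
  Some coordinate of \<open>\<theta>\<close> is at least \<open>1 / n\<close>. Shifting by \<open>s\<close> in this coordinate changes \<open>\<theta> \<bullet> x\<close> by at
  least \<open>s / n\<close>, so that \<open>\<bar>\<theta> \<bullet> x\<bar>\<close> cannot be small both at \<open>x\<close> and at the shifted point.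
\<close>
lemma integral_abs_inner_box_lower_bound:
  fixes \<theta> :: "real ^ 'n"
  assumes \<theta>: "norm \<theta> = 1" and s: "0 < s"
  defines "Q \<equiv> cbox 0 (\<chi> i. 2 * s)"
  shows "integrable lborel (\<lambda>x. indicator Q x * \<bar>\<theta> \<bullet> x\<bar>)"
    and "s ^ (CARD('n) + 1) / (2 * real CARD('n)) \<le> (\<integral>x. indicator Q x * \<bar>\<theta> \<bullet> x\<bar> \<partial>lborel)"
proof -
  let ?n = "real CARD('n)"
  let ?F = "\<lambda>x. indicator Q x * \<bar>\<theta> \<bullet> x\<bar> :: real"
  let ?Q = "cbox 0 (\<chi> i. s) :: (real ^ 'n) set"
  have "integrable lborel (\<lambda>x. indicator Q x *\<^sub>R \<bar>\<theta> \<bullet> x\<bar>)"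
    unfolding Q_def by (intro borel_integrable_compact compact_cbox continuous_intros)
  then show int: "integrable lborel ?F" by simp
  obtain i where i: "1 / ?n \<le> \<bar>\<theta> $ i\<bar>"
  proof -
    have "\<exists>i. 1 / ?n \<le> \<bar>\<theta> $ i\<bar>"
    proof (rule ccontr)
      assume "\<not> ?thesis"
      then have "(\<Sum>i\<in>UNIV. \<bar>\<theta> $ i\<bar>) < (\<Sum>i\<in>(UNIV :: 'n set). 1 / ?n)"
        by (intro sum_strict_mono) (auto simp: not_le)
      then have "(\<Sum>i\<in>UNIV. \<bar>\<theta> $ i\<bar>) < 1" by simp
      then show False using norm_le_l1_cart[of \<theta>] \<theta> by simp
    qed
    then show thesis using that by blast
  qed
  let ?c = "axis i s :: real ^ 'n"
  have "integrable (distr lborel borel ((+) ?c)) ?F" using int by (simp add: lborel_distr_plus)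
  then have int': "integrable lborel (\<lambda>x. ?F (?c + x))"
    by (subst (asm) integrable_distr_eq) (auto simp: Q_def)
  have shift: "(\<integral>x. ?F (?c + x) \<partial>lborel) = (\<integral>x. ?F x \<partial>lborel)"
  proof -
    have "(\<integral>x. ?F x \<partial>lborel) = (\<integral>x. ?F x \<partial>distr lborel borel ((+) ?c))" by (simp add: lborel_distr_plus)
    also have "\<dots> = (\<integral>x. ?F (?c + x) \<partial>lborel)" by (intro integral_distr) (auto simp: Q_def)
    finally show ?thesis ..
  qed
  have pw: "indicator ?Q x * (s / ?n) \<le> ?F x + ?F (?c + x)" for x
  proof (cases "x \<in> ?Q")
    case True
    then have "x \<in> Q" "?c + x \<in> Q" using s by (auto simp: Q_def mem_box_cart axis_def intro: order_trans)
    moreover have "s / ?n \<le> \<bar>\<theta> \<bullet> x\<bar> + \<bar>\<theta> \<bullet> (?c + x)\<bar>"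
    proof -
      have "s / ?n = s * (1 / ?n)" by simp
      also have "\<dots> \<le> s * \<bar>\<theta> $ i\<bar>" using i s by (intro mult_left_mono) auto
      also have "\<dots> = \<bar>\<theta> \<bullet> ?c\<bar>" using s by (simp add: inner_axis abs_mult)
      also have "\<dots> \<le> \<bar>\<theta> \<bullet> x\<bar> + \<bar>\<theta> \<bullet> (?c + x)\<bar>" by (simp add: inner_add_right)
      finally show ?thesis .
    qed
    ultimately show ?thesis using True by simp
  qed simp
  have intQ: "integrable lborel (\<lambda>x. indicator ?Q x * (s / ?n))"
    by (intro integrable_mult_left integrable_real_indicator) (use content_cube(2)[of s, where 'n = 'n] s in auto)
  have "s ^ CARD('n) * (s / ?n) = (\<integral>x. indicator ?Q x * (s / ?n) \<partial>lborel)"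
    using s by (simp add: content_cube)
  also have "\<dots> \<le> (\<integral>x. ?F x + ?F (?c + x) \<partial>lborel)"
    using int int' intQ by (intro integral_mono[OF _ _ pw] Bochner_Integration.integrable_add)
  also have "\<dots> = 2 * (\<integral>x. ?F x \<partial>lborel)" using int int' shift by simp
  finally show "s ^ (CARD('n) + 1) / (2 * ?n) \<le> (\<integral>x. ?F x \<partial>lborel)" by (simp add: field_simps)
qed

text \<open>
  Suppose \<open>\<psi> z > C\<close> for some \<open>z\<close> close to \<open>0\<close>. Separating \<open>z\<close> from the convex set \<open>{\<psi> \<le> C}\<close> gives a unit
  vector \<open>\<theta>\<close> such that \<open>\<psi> > C\<close> on the half-space \<open>\<theta> \<bullet> x \<ge> r\<close>. Hence the positive part of \<open>\<theta> \<bullet> x\<close> has a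
  small integral against \<open>exp (- \<psi>)\<close>: it is at most \<open>r\<close> off the half-space, and on the half-space
  \<open>exp (- \<psi>)\<close> is at most the geometric mean of \<open>exp (- C)\<close> and the majorant. As the first moment
  vanishes, the negative part has the same integral. But the integral of \<open>\<bar>\<theta> \<bullet> x\<bar>\<close> is bounded below,
  because \<open>\<psi> \<le> 1\<close> on a fixed box.
\<close>
lemma uniform_upper_bound_of_centroid:
  fixes a :: real
  assumes a: "0 < a"
  shows "\<exists>r>0. \<exists>C>0. \<forall>\<psi> :: real ^ 'n \<Rightarrow> ereal. \<psi> \<in> Cvx0 \<longrightarrow>
    (\<forall>x. ereal (a * norm x - 1) \<le> \<psi> x) \<longrightarrow> (\<forall>i. \<psi> (axis i 1) \<le> 1) \<longrightarrow>
    (\<integral>x. exp_neg (\<psi> x) *\<^sub>R x \<partial>lborel) = 0 \<longrightarrow> (\<forall>x. norm x < r \<longrightarrow> \<psi> x \<le> ereal C)"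
proof -
  \<comment> \<open>The box \<open>Q\<close> then has side \<open>1 / n\<close>, so that \<open>Cvx0_sublevel_contains_box\<close> applies.\<close>
  define s where "s = 1 / (2 * real CARD('n))"
  define Q :: "(real ^ 'n) set" where "Q = cbox 0 (\<chi> i. 2 * s)"
  define \<kappa> where "\<kappa> = exp (- 1) * (s ^ (CARD('n) + 1) / (2 * real CARD('n)))"
  define M1 where "M1 = (\<integral>x. exp (1 - a * norm (x :: real ^ 'n)) \<partial>lborel)"
  define M2 where "M2 = (\<integral>x. norm x * exp (1 / 2 - a / 2 * norm (x :: real ^ 'n)) \<partial>lborel)"
  have s: "0 < s" by (simp add: s_def)
  have \<kappa>: "0 < \<kappa>" using s by (simp add: \<kappa>_def)
  have M: "0 \<le> M1" "0 \<le> M2" by (auto simp: M1_def M2_def)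
  \<comment> \<open>Both error terms below are made smaller than \<open>\<kappa> / 2\<close>.\<close>
  define r where "r = \<kappa> / 8 / (M1 + 1)"
  define C where "C = max 1 (- 2 * ln (\<kappa> / 8 / (M2 + 1)))"
  have r: "0 < r" using \<kappa> M by (simp add: r_def)
  have C: "0 < C" by (simp add: C_def)
  have rM: "2 * r * M1 < \<kappa> / 2"
  proof -
    have "r * M1 < r * (M1 + 1)" using r by simp
    also have "\<dots> = \<kappa> / 8" using nonzero_divide_eq_eq[of "M1 + 1" "\<kappa> / 8" r] M r_def by simp
    finally show ?thesis using \<kappa> by simp
  qed
  have CM: "2 * exp (- C / 2) * M2 < \<kappa> / 2"
  proof -
    have "- C / 2 \<le> ln (\<kappa> / 8 / (M2 + 1))" by (simp add: C_def)
    then have "exp (- C / 2) \<le> exp (ln (\<kappa> / 8 / (M2 + 1)))" by (subst exp_le_cancel_iff)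
    also have "\<dots> = \<kappa> / 8 / (M2 + 1)" using \<kappa> M by (intro exp_ln) simp
    finally have "exp (- C / 2) * (M2 + 1) \<le> \<kappa> / 8 / (M2 + 1) * (M2 + 1)"
      using M by (intro mult_right_mono) auto
    also have "\<dots> = \<kappa> / 8"
      using nonzero_divide_eq_eq[of "M2 + 1" "\<kappa> / 8" "\<kappa> / 8 / (M2 + 1)"] M by simp
    finally have "exp (- C / 2) * (M2 + 1) \<le> \<kappa> / 8" .
    moreover have "exp (- C / 2) * M2 < exp (- C / 2) * (M2 + 1)" by simp
    ultimately show ?thesis using \<kappa> by linarith
  qed
  show ?thesis
  proof (rule exI[of _ r], rule conjI[OF r], rule exI[of _ C], rule conjI[OF C],
      intro allI impI, rule ccontr)
    fix \<psi> :: "real ^ 'n \<Rightarrow> ereal" and z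
    assume \<psi>: "\<psi> \<in> Cvx0" and growth': "\<forall>x. ereal (a * norm x - 1) \<le> \<psi> x"
      and ax': "\<forall>i. \<psi> (axis i 1) \<le> 1" and cen: "(\<integral>x. exp_neg (\<psi> x) *\<^sub>R x \<partial>lborel) = 0"
      and z: "norm z < r" "\<not> \<psi> z \<le> ereal C"
    note growth = growth'[rule_format] and ax = ax'[rule_format]
    let ?L = "{x. \<psi> x \<le> ereal C}"
    obtain w b where w: "w \<bullet> z < b" "\<And>x. x \<in> ?L \<Longrightarrow> b < w \<bullet> x"
      using separating_hyperplane_closed_point[OF convex_Cvx0_sublevel[OF \<psi>] Cvx0_closed[OF \<psi>], of z C] z
      by auto
    have "b < 0" using w(2)[of 0] C Cvx0_zero[OF \<psi>] by (simp add: zero_ereal_def)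
    then have w0: "w \<noteq> 0" using w(1) by auto
    define \<theta> where "\<theta> = (- 1 / norm w) *\<^sub>R w"
    have \<theta>: "norm \<theta> = 1" using w0 by (simp add: \<theta>_def)
    have far: "ereal C < \<psi> x" if x: "r \<le> \<theta> \<bullet> x" for x
    proof (rule ccontr)
      assume "\<not> ereal C < \<psi> x"
      then have "b < w \<bullet> x" by (intro w(2)) simp
      then have "w \<bullet> z < w \<bullet> x" using w(1) by simp
      then have "\<theta> \<bullet> x < \<theta> \<bullet> z" using w0 by (simp add: \<theta>_def divide_less_cancel)
      also have "\<dots> \<le> norm \<theta> * norm z" by (rule norm_cauchy_schwarz)
      finally show False using \<theta> z(1) x by simp
    qed
    define f where "f x = exp_neg (\<psi> x)" for x
    have f0: "0 \<le> f x" for x by (simp add: f_def)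
    have f1: "f x \<le> exp (1 - a * norm x)" for x
      using exp_neg_growth_bound[OF growth, of x] by (simp add: f_def)
    have f2: "f x \<le> exp (- C / 2) * exp (1 / 2 - a / 2 * norm x)" if x: "r \<le> \<theta> \<bullet> x" for x
    proof (cases "\<psi> x")
      case (real p)
      have "C < p" using far[OF x] real by simp
      moreover have "a * norm x - 1 \<le> p" using growth[of x] real by simp
      ultimately have "- p \<le> - C / 2 + (1 / 2 - a / 2 * norm x)" by simp
      then have "exp (- p) \<le> exp (- C / 2 + (1 / 2 - a / 2 * norm x))" by (subst exp_le_cancel_iff)
      then show ?thesis using real unfolding f_def exp_add by simp
    qed (use far[OF x] in \<open>auto simp: f_def\<close>)
    \<comment> \<open>The left-hand side is twice the positive part of \<open>\<theta> \<bullet> x\<close>, times \<open>f\<close>.\<close>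
    have key: "\<bar>\<theta> \<bullet> x\<bar> * f x + (\<theta> \<bullet> x) * f x
      \<le> 2 * r * exp (1 - a * norm x) + 2 * exp (- C / 2) * (norm x * exp (1 / 2 - a / 2 * norm x))" for x
    proof -
      have nn: "0 \<le> 2 * r * exp (1 - a * norm x)" "0 \<le> 2 * exp (- C / 2) * (norm x * exp (1 / 2 - a / 2 * norm x))"
        using r by auto
      consider "\<theta> \<bullet> x \<le> 0" | "0 < \<theta> \<bullet> x" "\<theta> \<bullet> x < r" | "r \<le> \<theta> \<bullet> x" by linarith
      then show ?thesis
      proof cases
        case 1
        then have "\<bar>\<theta> \<bullet> x\<bar> * f x + (\<theta> \<bullet> x) * f x = 0" by simp
        then show ?thesis using nn by linarith
      next
        case 2
        then have "(\<theta> \<bullet> x) * f x \<le> r * exp (1 - a * norm x)"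
          using f0 f1 by (intro mult_mono) auto
        then have "2 * ((\<theta> \<bullet> x) * f x) \<le> 2 * r * exp (1 - a * norm x)" by simp
        moreover have "\<bar>\<theta> \<bullet> x\<bar> * f x + (\<theta> \<bullet> x) * f x = 2 * ((\<theta> \<bullet> x) * f x)" using 2 by simp
        ultimately show ?thesis using nn(2) by linarith
      next
        case 3
        have "\<theta> \<bullet> x \<le> norm x" using norm_cauchy_schwarz[of \<theta> x] \<theta> by simp
        then have "(\<theta> \<bullet> x) * f x \<le> norm x * (exp (- C / 2) * exp (1 / 2 - a / 2 * norm x))"
          using f0 f2[OF 3] by (intro mult_mono) auto
        also have "\<dots> = exp (- C / 2) * (norm x * exp (1 / 2 - a / 2 * norm x))" by simp
        finally have "2 * ((\<theta> \<bullet> x) * f x)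
            \<le> 2 * exp (- C / 2) * (norm x * exp (1 / 2 - a / 2 * norm x))" by simp
        moreover have "\<bar>\<theta> \<bullet> x\<bar> * f x + (\<theta> \<bullet> x) * f x = 2 * ((\<theta> \<bullet> x) * f x)" using 3 r by simp
        ultimately show ?thesis using nn(1) by linarith
      qed
    qed
    have box: "exp (- 1) * (indicator Q x * \<bar>\<theta> \<bullet> x\<bar>) \<le> \<bar>\<theta> \<bullet> x\<bar> * f x" for x
    proof (cases "x \<in> Q")
      case True
      then have "0 \<le> x $ i" "x $ i \<le> 1 / CARD('n)" for i by (simp_all add: Q_def s_def mem_box_cart)
      then have "\<psi> x \<le> 1" by (rule Cvx0_sublevel_contains_box[OF \<psi> ax])
      then have "exp_neg 1 \<le> f x" unfolding f_def by (intro exp_neg_antimono Cvx0_nonneg[OF \<psi>])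
      then have "exp (- 1) \<le> f x" by (simp add: one_ereal_def)
      then have "exp (- 1) * \<bar>\<theta> \<bullet> x\<bar> \<le> f x * \<bar>\<theta> \<bullet> x\<bar>" by (rule mult_right_mono) simp
      then show ?thesis using True by (simp add: mult.commute)
    qed (use f0 in simp)
    have mom: "integrable lborel (\<lambda>x. f x *\<^sub>R x)"
      unfolding f_def by (rule first_moment_integrable[OF Cvx0_measurable[OF \<psi>] a growth])
    have int1: "integrable lborel (\<lambda>x. (\<theta> \<bullet> x) * f x)"
      using integrable_inner_right[OF mom, of \<theta>] by (simp add: mult.commute)
    have int2: "integrable lborel (\<lambda>x. \<bar>\<theta> \<bullet> x\<bar> * f x)"
      using integrable_abs[OF int1] f0 by (simp add: abs_mult)
    have zero: "(\<integral>x. (\<theta> \<bullet> x) * f x \<partial>lborel) = 0"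
      using integral_inner_right[OF mom, of \<theta>] cen by (simp add: f_def mult.commute)
    have i1: "integrable lborel (\<lambda>x :: real ^ 'n. exp (1 - a * norm x))" by (rule integrable_exp_norm[OF a])
    have i2: "integrable lborel (\<lambda>x :: real ^ 'n. norm x * exp (1 / 2 - a / 2 * norm x))"
      using a by (intro integrable_norm_exp_norm) simp
    note Qbound = integral_abs_inner_box_lower_bound[OF \<theta> s, folded Q_def]
    have "\<kappa> \<le> exp (- 1) * (\<integral>x. indicator Q x * \<bar>\<theta> \<bullet> x\<bar> \<partial>lborel)"
      unfolding \<kappa>_def using Qbound(2) by (intro mult_left_mono) auto
    also have "\<dots> = (\<integral>x. exp (- 1) * (indicator Q x * \<bar>\<theta> \<bullet> x\<bar>) \<partial>lborel)" by simp
    also have "\<dots> \<le> (\<integral>x. \<bar>\<theta> \<bullet> x\<bar> * f x \<partial>lborel)"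
      using Qbound(1) int2 by (intro integral_mono[OF _ _ box] integrable_mult_right)
    also have "\<dots> = (\<integral>x. \<bar>\<theta> \<bullet> x\<bar> * f x + (\<theta> \<bullet> x) * f x \<partial>lborel)"
      using int1 int2 zero by simp
    also have "\<dots> \<le> (\<integral>x. 2 * r * exp (1 - a * norm (x :: real ^ 'n))
        + 2 * exp (- C / 2) * (norm x * exp (1 / 2 - a / 2 * norm x)) \<partial>lborel)"
      using int1 int2 i1 i2
      by (intro integral_mono[OF _ _ key] Bochner_Integration.integrable_add integrable_mult_right)
    also have "\<dots> = 2 * r * M1 + 2 * exp (- C / 2) * M2"
      using i1 i2 by (simp add: M1_def M2_def)
    also have "\<dots> < \<kappa>" using rM CM by linarith
    finally show False by simp
  qed
qed

lemma ex_pinched_position: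
  "\<exists>a>0. \<exists>r>0. \<exists>C>0. \<forall>\<phi> :: real ^ 'n \<Rightarrow> ereal. \<phi> \<in> Cvx0_plus \<longrightarrow> centroid \<phi> = 0 \<longrightarrow>
    (\<exists>A :: real ^ 'n ^ 'n. det A \<noteq> 0 \<and> pinched a 1 r C (\<lambda>x. \<phi> (A *v x)))"
proof -
  define a where "a = 1 / (3 * real CARD('n))"
  have a: "0 < a" by (simp add: a_def)
  obtain r C where rC: "0 < r" "0 < C" and up:
    "\<forall>\<psi> :: real ^ 'n \<Rightarrow> ereal. \<psi> \<in> Cvx0 \<longrightarrow>
    (\<forall>x. ereal (a * norm x - 1) \<le> \<psi> x) \<longrightarrow> (\<forall>i. \<psi> (axis i 1) \<le> 1) \<longrightarrow>
    (\<integral>x. exp_neg (\<psi> x) *\<^sub>R x \<partial>lborel) = 0 \<longrightarrow> (\<forall>x. norm x < r \<longrightarrow> \<psi> x \<le> ereal C)"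
    using uniform_upper_bound_of_centroid[OF a, where 'n = 'n] by (elim exE conjE)
  have "\<exists>A :: real ^ 'n ^ 'n. det A \<noteq> 0 \<and> pinched a 1 r C (\<lambda>x. \<phi> (A *v x))"
    if \<phi>: "\<phi> \<in> Cvx0_plus" "centroid \<phi> = 0" for \<phi> :: "real ^ 'n \<Rightarrow> ereal"
  proof -
    obtain A :: "real ^ 'n ^ 'n" where A: "det A \<noteq> 0" "\<And>i. \<phi> (A *v axis i 1) \<le> 1"
      "\<And>y i. \<phi> (A *v y) \<le> 1 \<Longrightarrow> \<bar>y $ i\<bar> \<le> 2"
      using ex_normalising_matrix[OF \<phi>(1)] by blast
    let ?\<psi> = "\<lambda>x. \<phi> (A *v x)"
    have cvx: "?\<psi> \<in> Cvx0" using \<phi>(1) by (intro Cvx0_matrix) (simp add: Cvx0_plus_def)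
    have growth: "ereal (a * norm x - 1) \<le> ?\<psi> x" for x
      using growth_of_bounded_sublevel[OF cvx A(3), of x] by (simp add: a_def)
    have mom: "(\<integral>x. exp_neg (?\<psi> x) *\<^sub>R x \<partial>lborel) = 0"
      using centroid_matrix[OF \<phi>(1) A(1) \<phi>(2)] centroid_eq_0_iff[OF Cvx0_plus_matrix[OF \<phi>(1) A(1)]] by simp
    have "?\<psi> x \<le> ereal C" if "norm x < r" for x
      using up[rule_format, OF cvx growth A(2) mom that] .
    then show ?thesis using A(1) cvx growth by (auto simp: pinched_def)
  qed
  with a rC show ?thesis by blast
qed

section \<open>Existence of extremisers\<close>

lemma centroid_even:
  fixes \<phi> :: "'a::euclidean_space \<Rightarrow> ereal"
  assumes "\<phi> \<in> Cvx0_plus" "even_fun \<phi>"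
  shows "centroid \<phi> = 0"
proof -
  have [measurable]: "(\<lambda>x. exp_neg (\<phi> x)) \<in> borel_measurable borel"
    using assms(1) by (simp add: Cvx0_plus_def exp_neg_measurable_comp Cvx0_measurable)
  have "(lborel :: 'a measure) = density (distr lborel borel (\<lambda>x. - x)) (\<lambda>_. 1)"
    using lborel_affine[of "- 1" "0 :: 'a"] by simp
  then have "(lborel :: 'a measure) = distr lborel borel (\<lambda>x. - x)" by (simp add: density_1)
  then have "(\<integral>x. exp_neg (\<phi> x) *\<^sub>R x \<partial>lborel) = (\<integral>x. exp_neg (\<phi> x) *\<^sub>R x \<partial>distr lborel borel (\<lambda>x. - x))"
    by simp
  also have "\<dots> = - (\<integral>x. exp_neg (\<phi> x) *\<^sub>R x \<partial>lborel)"
    using assms(2) by (subst integral_distr) (auto simp: even_fun_def)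
  finally have "(\<integral>x. exp_neg (\<phi> x) *\<^sub>R x \<partial>lborel) = 0" by (simp add: eq_neg_iff_add_eq_0 flip: scaleR_2)
  then show ?thesis using centroid_eq_0_iff[OF assms(1)] by simp
qed

lemma norm_even_Cvx0_plus:
  shows "(\<lambda>x :: 'a::euclidean_space. ereal (norm x)) \<in> Cvx0_plus" "even_fun (\<lambda>x :: 'a. ereal (norm x))"
proof -
  let ?\<phi> = "\<lambda>x :: 'a. ereal (norm x)"
  have "open {x. c < ?\<phi> x}" for c by (intro open_Collect_less continuous_intros)
  then have "lower_semicontinuous ?\<phi>" by (simp add: lower_semicontinuous_iff_open)
  moreover have "convex_ereal ?\<phi>"
    unfolding convex_ereal_def
  proof (intro allI ballI)
    fix x y :: 'a and t :: real assume "t \<in> {0..1}"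
    then have "norm ((1 - t) *\<^sub>R x + t *\<^sub>R y) \<le> (1 - t) * norm x + t * norm y"
      by (intro norm_triangle_le) simp
    then show "?\<phi> ((1 - t) *\<^sub>R x + t *\<^sub>R y) \<le> ereal (1 - t) * ?\<phi> x + ereal t * ?\<phi> y" by simp
  qed
  ultimately have "?\<phi> \<in> Cvx0" by (simp add: Cvx0_def zero_ereal_def)
  then have "pinched 1 0 1 1 ?\<phi>" by (auto simp: pinched_def one_ereal_def)
  then show "?\<phi> \<in> Cvx0_plus" by (rule pinched_Cvx0_plus) auto
  show "even_fun ?\<phi>" by (simp add: even_fun_def)
qed

theorem theorem1p1:
  shows "achieves_max_on P_A {\<phi> :: real ^ 'n \<Rightarrow> ereal. \<phi> \<in> Cvx0_plus \<and> even_fun \<phi>} \<and>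
         achieves_min_on P_A {\<phi> :: real ^ 'n \<Rightarrow> ereal. \<phi> \<in> Cvx0_plus \<and> even_fun \<phi>} \<and>
         achieves_max_on P_A {\<phi> :: real ^ 'n \<Rightarrow> ereal. \<phi> \<in> Cvx0_plus \<and> centroid \<phi> = 0} \<and>
         achieves_min_on P_A {\<phi> :: real ^ 'n \<Rightarrow> ereal. \<phi> \<in> Cvx0_plus \<and> centroid \<phi> = 0}"
proof -
  let ?E = "{\<phi> :: real ^ 'n \<Rightarrow> ereal. \<phi> \<in> Cvx0_plus \<and> even_fun \<phi>}"
  let ?Z = "{\<phi> :: real ^ 'n \<Rightarrow> ereal. \<phi> \<in> Cvx0_plus \<and> centroid \<phi> = 0}"
  obtain a r C where pos: "0 < a" "0 < r" "0 < C" and "\<forall>\<phi> :: real ^ 'n \<Rightarrow> ereal.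
      \<phi> \<in> Cvx0_plus \<longrightarrow> centroid \<phi> = 0 \<longrightarrow>
      (\<exists>A :: real ^ 'n ^ 'n. det A \<noteq> 0 \<and> pinched a 1 r C (\<lambda>x. \<phi> (A *v x)))"
    using ex_pinched_position[where 'n = 'n] by (elim exE conjE)
  note position = this(4)[rule_format]
  have limit: "\<phi> \<in> Cvx0_plus"
    if "epi_converges \<phi>s \<phi>" "\<And>k. pinched a 1 r C (\<phi>s k)" for \<phi>s and \<phi> :: "real ^ 'n \<Rightarrow> ereal"
    using pinched_Cvx0_plus[OF pinched_epi_limit[OF that] pos(1,2)] .
  have E: "achieves_max_on P_A ?E \<and> achieves_min_on P_A ?E"
  proof (rule achieves_extrema_by_pinching[OF pos])
    show "?E \<noteq> {}" using norm_even_Cvx0_plus by blast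
    show "\<exists>\<psi>\<in>?E. pinched a 1 r C \<psi> \<and> P_A \<psi> = P_A \<phi>" if "\<phi> \<in> ?E" for \<phi>
    proof -
      have \<phi>: "\<phi> \<in> Cvx0_plus" "\<phi> \<in> Cvx0" "even_fun \<phi>" using that by (auto simp: Cvx0_plus_def)
      obtain A where A: "det A \<noteq> 0" "pinched a 1 r C (\<lambda>x. \<phi> (A *v x))"
        using position[OF \<phi>(1) centroid_even[OF \<phi>(1,3)]] by blast
      show ?thesis
        using A Cvx0_plus_matrix[OF \<phi>(1) A(1)] even_matrix[OF \<phi>(3)] P_A_matrix[OF \<phi>(2) A(1)]
        by (intro bexI[of _ "\<lambda>x. \<phi> (A *v x)"]) auto
    qed
    show "\<phi> \<in> ?E" if "epi_converges \<phi>s \<phi>" "\<And>k. \<phi>s k \<in> ?E" "\<And>k. pinched a 1 r C (\<phi>s k)" for \<phi>s \<phi>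
      using limit[OF that(1,3)] even_epi_limit[OF that(1)] that(2) by simp
  qed
  have Z: "achieves_max_on P_A ?Z \<and> achieves_min_on P_A ?Z"
  proof (rule achieves_extrema_by_pinching[OF pos])
    show "?Z \<noteq> {}" using norm_even_Cvx0_plus centroid_even by blast
    show "\<exists>\<psi>\<in>?Z. pinched a 1 r C \<psi> \<and> P_A \<psi> = P_A \<phi>" if "\<phi> \<in> ?Z" for \<phi>
    proof -
      have \<phi>: "\<phi> \<in> Cvx0_plus" "\<phi> \<in> Cvx0" "centroid \<phi> = 0" using that by (auto simp: Cvx0_plus_def)
      obtain A where A: "det A \<noteq> 0" "pinched a 1 r C (\<lambda>x. \<phi> (A *v x))"
        using position[OF \<phi>(1,3)] by blast
      show ?thesis
        using A Cvx0_plus_matrix[OF \<phi>(1) A(1)] centroid_matrix[OF \<phi>(1) A(1) \<phi>(3)] P_A_matrix[OF \<phi>(2) A(1)]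
        by (intro bexI[of _ "\<lambda>x. \<phi> (A *v x)"]) auto
    qed
    show "\<phi> \<in> ?Z" if "epi_converges \<phi>s \<phi>" "\<And>k. \<phi>s k \<in> ?Z" "\<And>k. pinched a 1 r C (\<phi>s k)" for \<phi>s \<phi>
    proof -
      have "(\<lambda>k. \<integral>x. exp_neg (\<phi>s k x) *\<^sub>R x \<partial>lborel) = (\<lambda>k. 0)"
        using that(2) centroid_eq_0_iff by fastforce
      then have "(\<integral>x. exp_neg (\<phi> x) *\<^sub>R x \<partial>lborel) = 0"
        using LIMSEQ_unique[OF pinched_limit(2)[OF that(1,3) pos], of 0] by simp
      then show ?thesis using centroid_eq_0_iff[OF limit[OF that(1,3)]] limit[OF that(1,3)] by simp
    qed
  qed
  from E Z show ?thesis by simp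
qed

end
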